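(* Let $X$ be a set of regular cardinality $\kappa=\aleph_\alpha$. Then there exist (exactly) $\max(|\alpha|,\aleph_0)$ maximal clones on $X$ which contain all permutations of $X$ but not all unary functions on $X$.
   Context: Let $\mathcal{O}^{(n)}$ be the set of all functions $X^n\to X$ and $\mathcal{O}=\bigcup_{n\ge1}\mathcal{O}^{(n)}$. A clone on $X$ is a subset of $\mathcal{O}$ containing all projections and closed under composition. A maximal clone is a dual atom of the lattice of clones on $X$ (ordered by inclusion), i.e. a clone $\mathcal{C}\ne\mathcal{O}$ such that no clone lies strictly between $\mathcal{C}$ and $\mathcal{O}$. Unary functions are the functions $X\to X$. *)

theory Defs
  imports Main "HOL-Library.FuncSet"
begin

unbundle cardinal_syntax

text \<open>
  The least infinite cardinal above every cardinal in \<open>R\<close>. As \<open>k\<close> itself lives on the type \<open>'a\<close>,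
  so does (up to \<open>=o\<close>) every smaller cardinal, hence minimality over cardinals on \<open>'a\<close> is absolute.
\<close>

definition least_infinite_above :: "'a rel set \<Rightarrow> 'a rel \<Rightarrow> bool" where
  "least_infinite_above R k \<longleftrightarrow>
     Cinfinite k \<and> (\<forall>r\<in>R. r <o k) \<and>
     (\<forall>k' :: 'a rel. Cinfinite k' \<and> (\<forall>r\<in>R. r <o k') \<longrightarrow> k \<le>o k')"

text \<open>
  \<open>is_aleph \<alpha> \<kappa>\<close> means that \<open>\<kappa>\<close> is the \<open>\<alpha>\<close>-th aleph, where the ordinal \<open>\<alpha>\<close> is given as a
  well-order on some type. An element \<open>b\<close> of \<open>Field \<alpha>\<close> stands for the ordinal \<open>\<beta> < \<alpha>\<close> that is
  the type of \<open>underS \<alpha> b\<close>, and \<open>A b\<close> is the \<open>\<beta>\<close>-th aleph: the least infinite cardinal above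
  all earlier alephs. This one clause covers zero, successors and limits.
\<close>

definition is_aleph :: "'b rel \<Rightarrow> 'a rel \<Rightarrow> bool" where
  "is_aleph \<alpha> \<kappa> \<longleftrightarrow>
     Well_order \<alpha> \<and>
     (\<exists>A :: 'b \<Rightarrow> 'a rel.
        (\<forall>b\<in>Field \<alpha>. least_infinite_above (A ` underS \<alpha> b) (A b)) \<and>
        least_infinite_above (A ` Field \<alpha>) \<kappa>)"

text \<open>The larger of two cardinals, on a common type.\<close>

definition card_max :: "'a rel \<Rightarrow> 'b rel \<Rightarrow> ('a + 'b) rel" where
  "card_max r s = (if r \<le>o s then |Inr ` Field s| else |Inl ` Field r| )"

text \<open>
  The base set is the type \<open>'a\<close>. An \<open>n\<close>-ary operation is a pair \<open>(n, f)\<close> with \<open>f\<close> defined on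
  argument lists of length \<open>n\<close>. The arity is recorded because functions in \<open>\<rightarrow>\<^sub>E\<close> return
  \<open>undefined\<close> outside their domain, so the constant functions with value \<open>undefined\<close> of different
  arities would otherwise coincide.
\<close>

type_synonym 'a operation = "nat \<times> ('a list \<Rightarrow> 'a)"

definition tuples :: "nat \<Rightarrow> 'a list set" where
  "tuples n = {xs. length xs = n}"

definition operations :: "'a operation set" where
  "operations = (SIGMA n:{1..}. tuples n \<rightarrow>\<^sub>E UNIV)"

definition projection :: "nat \<Rightarrow> nat \<Rightarrow> 'a operation" where
  "projection n i = (n, \<lambda>xs\<in>tuples n. xs ! i)"

definition compose_ops :: "nat \<Rightarrow> ('a list \<Rightarrow> 'a) \<Rightarrow> ('a list \<Rightarrow> 'a) list \<Rightarrow> 'a operation" where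
  "compose_ops m f gs = (m, \<lambda>xs\<in>tuples m. f (map (\<lambda>g. g xs) gs))"

definition clone :: "'a operation set \<Rightarrow> bool" where
  "clone C \<longleftrightarrow>
     C \<subseteq> operations \<and>
     (\<forall>n i. i < n \<longrightarrow> projection n i \<in> C) \<and>
     (\<forall>n m f gs. (n, f) \<in> C \<and> length gs = n \<and> (\<forall>g\<in>set gs. (m, g) \<in> C)
        \<longrightarrow> compose_ops m f gs \<in> C)"

definition maximal_clone :: "'a operation set \<Rightarrow> bool" where
  "maximal_clone C \<longleftrightarrow>
     clone C \<and> C \<noteq> operations \<and> \<not> (\<exists>D. clone D \<and> C \<subset> D \<and> D \<subset> operations)"

definition unary :: "('a \<Rightarrow> 'a) \<Rightarrow> 'a operation" where
  "unary h = (1, \<lambda>xs\<in>tuples 1. h (xs ! 0))"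

end

theory Submission
  imports Defs "HOL-Library.Countable_Set"
begin

text \<open>
  Call a set small if its cardinality is less than that of the base set. Let \<open>C\<close> be a maximal clone
  that contains the permutations but not all unary functions. If \<open>C\<close> is contained in a proper clone,
  then it is equal to it; so if \<open>C\<close> is none of the clones \<open>Pol K\<close> for four special sets \<open>K\<close> of unary
  functions and for the monoids \<open>G\<^sub>\<lambda>\<close>, with \<open>1 \<le> \<lambda> \<le> \<kappa>\<close>, then it contains an operation outside
  each of these and outside the clone of almost unary operations. From the operations outside the
  clones \<open>Pol K\<close> one gets, by thinning out domains and extending partial injections to permutations,
  all surjections with only large fibres. An operation that is not almost unary then produces an
  injection with colarge range, and all unary functions factor through these. This contradiction
  bounds the number of clones by that of the cardinals \<open>\<lambda>\<close>. Conversely, all \<open>Pol G\<^sub>\<lambda>\<close> are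
  maximal and they are distinct.
\<close>

section \<open>Large and small sets\<close>

text \<open>A witness that an operation of \<open>C\<close> lies outside \<open>Pol K\<close>
  consists of inner functions from \<open>K\<close>, and these need not be in \<open>C\<close>. So
  they are replaced by members of the unary part \<open>M\<close> that agree with them on enough
  points to preserve the relevant fibres or range. One source of such members is the permutations,
  which extend partial injections. The other is the \<open>full\<close> functions: up to
  permutations on both sides they are determined by the cardinalities of the range and of its
  complement, so one full member of \<open>M\<close> supplies all others of its type. Any function
  on pairs becomes full, with the same range, after composition with a full surjection onto the
  pairs. Pairs with a Boolean recur for this reason: one half carries prescribed values, the other
  corrects the range or is kept back to make a complement large.\<close>

lemma bij_if_combine:
  assumes "bij_betw f A B" "bij_betw g (- A) (- B)"
  shows "bij (\<lambda>x. if x \<in> A then f x else g x)"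
proof -
  have "bij_betw (\<lambda>x. if x \<in> A then f x else g x) (A \<union> - A) (B \<union> - B)"
  proof (rule bij_betw_combine)
    show "bij_betw (\<lambda>x. if x \<in> A then f x else g x) A B"
      using assms(1) by (rule bij_betw_cong[THEN iffD1, rotated]) simp
    show "bij_betw (\<lambda>x. if x \<in> A then f x else g x) (- A) (- B)"
      using assms(2) by (rule bij_betw_cong[THEN iffD1, rotated]) simp
  qed simp
  then show ?thesis by simp
qed

lemma ex_bij_comp:
  fixes f g :: "'x \<Rightarrow> 'y"
  assumes "\<And>y. |f -` {y}| =o |g -` {y}|"
  shows "\<exists>q. bij q \<and> f = g \<circ> q"
proof -
  have "\<exists>b. bij_betw b (f -` {y}) (g -` {y})" for y
    using assms card_of_ordIso by blast
  then obtain b where b: "\<And>y. bij_betw (b y) (f -` {y}) (g -` {y})" by metis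
  define q where "q x = b (f x) x" for x
  have gq: "g (q x) = f x" for x
    using b[of "f x"] unfolding q_def bij_betw_def by auto
  have "bij q"
  proof (rule bijI)
    show "inj q"
    proof (rule injI)
      fix x x' assume eq: "q x = q x'"
      then have "f x = f x'" using gq by metis
      with eq b[of "f x"] show "x = x'"
        unfolding q_def bij_betw_def inj_on_def by auto
    qed
    show "surj q"
    proof (rule surjI)
      fix z show "q (inv_into (f -` {g z}) (b (g z)) z) = z"
      proof -
        have z: "z \<in> b (g z) ` (f -` {g z})" using b[of "g z"] unfolding bij_betw_def by auto
        show ?thesis
          using f_inv_into_f[OF z] inv_into_into[OF z] unfolding q_def by simp
      qed
    qed
  qed
  with gq show ?thesis by (auto simp: fun_eq_iff)
qed

text \<open>Keeping the base set as a parameter \<open>U\<close> lets \<open>small\<close> apply to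
  sets over any type: a definition at type \<open>'c set\<close> could not mention the type
  \<open>'a\<close>.\<close>

locale regular_universe =
  fixes U :: "'a set"
  assumes U_UNIV: "U = UNIV"
    and infinite_U: "infinite U"
    and regular_U: "regularCard |U|"
begin

definition small :: "'c set \<Rightarrow> bool" where
  "small A \<longleftrightarrow> |A| <o |U|"

lemma not_small: "\<not> small A \<longleftrightarrow> |U| \<le>o |A|"
  unfolding small_def by (simp add: card_of_Well_order not_ordLess_iff_ordLeq)

lemma small_ordLeq: "|A| \<le>o |B| \<Longrightarrow> small B \<Longrightarrow> small A"
  unfolding small_def by (rule ordLeq_ordLess_trans)

lemma small_mono: "A \<subseteq> B \<Longrightarrow> small B \<Longrightarrow> small A"
  by (rule small_ordLeq[OF card_of_mono1])

lemma small_image: "small A \<Longrightarrow> small (f ` A)"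
  using card_of_image small_ordLeq by blast

lemma small_image_iff: "inj_on f A \<Longrightarrow> small (f ` A) \<longleftrightarrow> small A"
  using small_ordLeq[OF card_of_ordLeqI[of f A "f ` A"]] small_image by blast

lemma small_finite: "finite A \<Longrightarrow> small A"
  using infinite_U card_of_ordLeq_finite[of U A] not_small[of A] by blast

lemma small_empty [simp]: "small {}"
  by (simp add: small_finite)

text \<open>Regularity enters here, as stability of the cardinal; the pigeonhole arguments rest on
  it.\<close>

lemma small_UN:
  assumes "small I" "\<And>i. i \<in> I \<Longrightarrow> small (A i)"
  shows "small (\<Union>i\<in>I. A i)"
proof -
  have "stable |U|"
    by (rule regularCard_stable) (use regular_U infinite_U in \<open>auto simp: card_of_card_order_on Field_card_of\<close>)
  then show ?thesis using assms unfolding small_def by (intro stable_UNION) auto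
qed

lemma small_Un: "small A \<Longrightarrow> small B \<Longrightarrow> small (A \<union> B)"
  unfolding small_def using infinite_U card_of_Un_ordLess_infinite by blast

lemma not_small_Diff: "\<not> small A \<Longrightarrow> small B \<Longrightarrow> \<not> small (A - B)"
  using small_Un[of "A - B" B] small_mono[of A "A - B \<union> B"] by blast

lemma card_of_le_U: "|A :: 'a set| \<le>o |U|"
  unfolding U_UNIV by (rule card_of_mono1) simp

lemma not_small_U: "\<not> small U" "\<not> small (UNIV :: 'a set)"
  using ordIso_imp_ordLeq[OF card_of_refl, of U] unfolding not_small by (simp_all add: U_UNIV)

lemma not_small_Compl: "small A \<Longrightarrow> \<not> small (- A :: 'a set)"
  unfolding Compl_eq_Diff_UNIV by (rule not_small_Diff[OF not_small_U(2)])

lemma ex_bij_large: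
  assumes "\<not> small A" "|A| \<le>o |U|" "\<not> small B" "|B| \<le>o |U|"
  shows "\<exists>f. bij_betw f A B"
  unfolding card_of_ordIso ordIso_iff_ordLeq using assms unfolding not_small
  by (auto elim: ordLeq_transitive)

lemma card_of_Times_le_U:
  assumes "|A| \<le>o |U|" "|B| \<le>o |U|"
  shows "|A \<times> B| \<le>o |U|"
  by (rule card_of_Times_ordLeq_infinite_Field)
    (use assms infinite_U in \<open>auto simp: card_of_card_order_on Field_card_of\<close>)

lemma finite_le_U: "finite A \<Longrightarrow> |A| \<le>o |U|"
  using small_finite[of A] unfolding small_def by (rule ordLess_imp_ordLeq)

lemma not_small_Times:
  assumes "\<not> small A" "B \<noteq> {}"
  shows "\<not> small (A \<times> B)" "\<not> small (B \<times> A)"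
  using small_ordLeq[OF card_of_Times1[of B A]] small_ordLeq[OF card_of_Times2[of B A]] assms
  by blast+

lemma ex_bij_Times:
  assumes "\<not> small A" "|A| \<le>o |U|" "B \<noteq> {}" "|B| \<le>o |U|"
  shows "\<exists>f. bij_betw f ((UNIV :: 'a set) \<times> B) A"
  using assms by (intro ex_bij_large not_small_U card_of_le_U card_of_Times_le_U not_small_Times)

text \<open>A large set splits into two large halves. \<open>B\<close> is taken inside one of them
  and the other remains in \<open>A - B\<close>.\<close>

lemma subset_of_card:
  fixes A :: "'a set"
  assumes "\<not> small A" "|E| \<le>o |U|"
  shows "\<exists>B\<subseteq>A. |B| =o |E| \<and> \<not> small (A - B)"
proof -
  obtain j where j: "bij_betw j ((UNIV :: 'a set) \<times> (UNIV :: bool set)) A"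
    using ex_bij_Times[OF assms(1) card_of_le_U UNIV_not_empty finite_le_U[OF finite]] by blast
  have large: "\<not> small (j ` (UNIV \<times> {b}))" for b
  proof -
    have "inj_on j (UNIV \<times> {b})" using j unfolding bij_betw_def by (auto elim: inj_on_subset)
    then show ?thesis by (simp add: small_image_iff not_small_Times(1)[OF not_small_U(2)])
  qed
  have "|E| \<le>o |j ` (UNIV \<times> {True})|"
    using assms(2) large[of True] ordLeq_transitive unfolding not_small by blast
  then obtain B where B: "B \<subseteq> j ` (UNIV \<times> {True})" "|E| =o |B|"
    using internalize_card_of_ordLeq2[THEN iffD1] by blast
  define T F where TF: "T = j ` (UNIV \<times> {True})" "F = j ` (UNIV \<times> {False})"
  have A: "A = j ` (UNIV \<times> UNIV)" using j by (simp add: bij_betw_def)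
  have "T \<inter> F = j ` (UNIV \<times> {True} \<inter> UNIV \<times> {False})"
    unfolding TF using j by (intro inj_on_image_Int[symmetric, of j "UNIV \<times> UNIV"]) (auto simp: bij_betw_def)
  also have "(UNIV :: 'a set) \<times> {True} \<inter> UNIV \<times> {False} = {}" by blast
  finally have "T \<inter> F = {}" by simp
  moreover have "T \<subseteq> A" "F \<subseteq> A" unfolding TF A by auto
  ultimately have "F \<subseteq> A - B" "B \<subseteq> A" using B(1) unfolding TF(1)[symmetric] by blast+
  with large[of False] B(2) show ?thesis
    unfolding TF(2)[symmetric] using small_mono ordIso_symmetric by blast
qed

text \<open>Both complements are large, hence equipotent, and any bijection between them completes
  \<open>g\<close>.\<close>

lemma ex_perm_extending:
  fixes g :: "'a \<Rightarrow> 'a"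
  assumes "inj_on g W" "\<not> small (- W)" "\<not> small (- g ` W)"
  shows "\<exists>p. bij p \<and> (\<forall>x\<in>W. p x = g x)"
proof -
  obtain k where "bij_betw k (- W) (- g ` W)"
    using ex_bij_large assms card_of_le_U by blast
  then have "bij (\<lambda>x. if x \<in> W then g x else k x)"
    using assms(1) by (intro bij_if_combine) (auto simp: bij_betw_def)
  then show ?thesis by (intro exI[of _ "\<lambda>x. if x \<in> W then g x else k x"]) auto
qed

lemma ex_perm_into:
  fixes A B :: "'a set"
  assumes "\<not> small (- A)" "\<not> small B"
  shows "\<exists>p. bij p \<and> p ` A \<subseteq> B"
proof -
  obtain B' where B': "B' \<subseteq> B" "|B'| =o |A|" "\<not> small (B - B')"
    using subset_of_card assms card_of_le_U by meson
  obtain k where k: "bij_betw k A B'" using B' card_of_ordIso ordIso_symmetric by blast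
  have "\<not> small (- B')" using B'(3) small_mono by (metis Diff_eq Int_lower2)
  then obtain p where "bij p" "\<forall>x\<in>A. p x = k x"
    using ex_perm_extending[of k A] k assms unfolding bij_betw_def by auto
  then show ?thesis using B' k unfolding bij_betw_def by auto
qed

text \<open>Transfinite recursion along the cardinal \<open>|I|\<close>: its proper initial segments
  are small, so \<open>step\<close> always finds a value that is new under every \<open>g\<close> in
  \<open>G\<close> at once.\<close>

lemma greedy_choice:
  fixes H :: "'i \<Rightarrow> 't set" and G :: "('t \<Rightarrow> 'v) set"
  assumes I: "|I| \<le>o |U|"
    and step: "\<And>i D. i \<in> I \<Longrightarrow> small D \<Longrightarrow> \<exists>t\<in>H i. \<forall>g\<in>G. \<forall>d\<in>D. g t \<noteq> g d"
  shows "\<exists>e. (\<forall>i\<in>I. e i \<in> H i) \<and> (\<forall>g\<in>G. inj_on (g \<circ> e) I)"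
proof -
  define r where "r = |I|"
  have wo: "Well_order r" and F: "Field r = I" and co: "Card_order r"
    unfolding r_def by (auto simp: Field_card_of card_of_card_order_on card_of_well_order_on)
  interpret R: wo_rel r by (simp add: wo_rel_def wo)
  define e where "e = R.worec (\<lambda>e i. SOME t. t \<in> H i \<and> (\<forall>g\<in>G. \<forall>d\<in>e ` R.underS i. g t \<noteq> g d))"
  have adm: "R.adm_wo (\<lambda>e i. SOME t. t \<in> H i \<and> (\<forall>g\<in>G. \<forall>d\<in>e ` R.underS i. g t \<noteq> g d))"
    unfolding R.adm_wo_def by (auto simp: image_def)
  have e_unfold: "e i = (SOME t. t \<in> H i \<and> (\<forall>g\<in>G. \<forall>d\<in>e ` R.underS i. g t \<noteq> g d))" for i
    unfolding e_def by (subst R.worec_fixpoint[OF adm]) simp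
  have e: "e i \<in> H i \<and> (\<forall>g\<in>G. \<forall>d\<in>e ` R.underS i. g (e i) \<noteq> g d)" if "i \<in> I" for i
  proof -
    have "small (R.underS i)"
      using ordLess_ordLeq_trans[OF card_of_underS[OF co] I[folded r_def]] that F
      unfolding small_def by simp
    from step[OF that small_image[OF this, of e]]
    have "\<exists>t. t \<in> H i \<and> (\<forall>g\<in>G. \<forall>d\<in>e ` R.underS i. g t \<noteq> g d)" by blast
    from someI_ex[OF this] show ?thesis unfolding e_unfold[of i] .
  qed
  have "inj_on (g \<circ> e) I" if "g \<in> G" for g
  proof (rule inj_onI)
    fix i i' assume i: "i \<in> I" "i' \<in> I" "(g \<circ> e) i = (g \<circ> e) i'"
    show "i = i'"
    proof (rule ccontr)
      assume "i \<noteq> i'"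
      then have "i \<in> R.underS i' \<or> i' \<in> R.underS i"
        using R.TOTALS F i unfolding underS_def by auto
      then show False using e i that by fastforce
    qed
  qed
  with e show ?thesis by blast
qed

section \<open>Functions with only large fibres\<close>

definition full :: "('c \<Rightarrow> 'b) \<Rightarrow> bool" where
  "full u \<longleftrightarrow> (\<forall>y\<in>range u. \<not> small (u -` {y}))"

lemma full_comp: "full u \<Longrightarrow> full (\<phi> \<circ> u)"
  unfolding full_def
proof safe
  fix x assume *: "\<forall>y\<in>range u. \<not> small (u -` {y})" "small ((\<phi> \<circ> u) -` {(\<phi> \<circ> u) x})"
  have "u -` {u x} \<subseteq> (\<phi> \<circ> u) -` {(\<phi> \<circ> u) x}" by auto
  then show False using * small_mono by blast
qed

lemma ex_full_surj:
  assumes "\<not> small A" "|A| \<le>o |U|" "B \<noteq> {}" "|B| \<le>o |U|"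
  shows "\<exists>w. w ` A = B \<and> (\<forall>y\<in>B. \<not> small {x\<in>A. w x = y})"
proof -
  obtain j where j: "bij_betw j ((UNIV :: 'a set) \<times> B) A"
    using ex_bij_Times[OF assms] by blast
  define w where "w = snd \<circ> inv_into (UNIV \<times> B) j"
  have wj: "w (j (a, b)) = b" if "b \<in> B" for a b
    using that j unfolding w_def bij_betw_def by simp
  have A: "A = j ` (UNIV \<times> B)" using j by (simp add: bij_betw_def)
  then have "w ` A = (w \<circ> j) ` (UNIV \<times> B)" by (simp only: image_comp)
  also have "\<dots> = snd ` ((UNIV :: 'a set) \<times> B)" by (rule image_cong) (auto simp: wj)
  finally have "w ` A = B" by simp
  moreover have "\<not> small {x\<in>A. w x = y}" if "y \<in> B" for y
  proof -
    have "j ` (UNIV \<times> {y}) \<subseteq> {x\<in>A. w x = y}" unfolding A using wj that by auto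
    moreover have "\<not> small (j ` (UNIV \<times> {y}))"
    proof -
      have "inj_on j (UNIV \<times> {y})" using j that unfolding bij_betw_def by (auto elim: inj_on_subset)
      then show ?thesis by (simp add: small_image_iff not_small_Times(1)[OF not_small_U(2)])
    qed
    ultimately show ?thesis using small_mono by blast
  qed
  ultimately show ?thesis by blast
qed

lemma ex_full_surj_UNIV:
  assumes "(B :: 'c set) \<noteq> {}" "|B| \<le>o |U|"
  shows "\<exists>w :: 'a \<Rightarrow> 'c. range w = B \<and> full w"
proof -
  from ex_full_surj[OF not_small_U(2) card_of_le_U assms]
  obtain w :: "'a \<Rightarrow> 'c" where w: "range w = B" "\<forall>y\<in>B. \<not> small {x\<in>UNIV. w x = y}" by blast
  have "{x \<in> UNIV. w x = y} = w -` {y}" for y by auto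
  with w show ?thesis unfolding full_def by auto
qed

text \<open>Once \<open>p\<close> has matched the ranges, corresponding fibres are both empty or
  both large, hence equipotent, and \<open>ex_bij_comp\<close> supplies \<open>q\<close>.\<close>

lemma full_equiv:
  fixes u w :: "'a \<Rightarrow> 'a"
  assumes "full u" "full w" "|range u| =o |range w|" "|- range u| =o |- range w|"
  shows "\<exists>p q. bij p \<and> bij q \<and> w = p \<circ> u \<circ> q"
proof -
  obtain f g where fg: "bij_betw f (range u) (range w)" "bij_betw g (- range u) (- range w)"
    using assms(3,4) unfolding card_of_ordIso[symmetric] by blast
  define p where "p = (\<lambda>x. if x \<in> range u then f x else g x)"
  have p: "bij p" unfolding p_def using fg by (rule bij_if_combine)
  have r: "range (p \<circ> u) = range w"
  proof -
    have "range (p \<circ> u) = f ` range u" unfolding p_def by auto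
    then show ?thesis using fg(1) by (simp add: bij_betw_def)
  qed
  have full_pu: "full (p \<circ> u)" using assms(1) by (rule full_comp)
  have "|w -` {y}| =o |(p \<circ> u) -` {y}|" for y
  proof (cases "y \<in> range w")
    case True
    then have "\<not> small (w -` {y})" "\<not> small ((p \<circ> u) -` {y})"
      using assms(2) full_pu r unfolding full_def by blast+
    then show ?thesis using ex_bij_large card_of_le_U card_of_ordIso by blast
  next
    case False
    then have "w -` {y} = {}" "(p \<circ> u) -` {y} = {}" using r by auto
    then show ?thesis by (simp add: card_of_refl)
  qed
  from ex_bij_comp[OF this] p show ?thesis by (auto simp: o_assoc)
qed

end

section \<open>Clones of polymorphisms of sets of unary functions\<close>

definition unary_part :: "'a operation set \<Rightarrow> ('a \<Rightarrow> 'a) set" where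
  "unary_part C = {h. unary h \<in> C}"

definition apply_unary :: "('a list \<Rightarrow> 'a) \<Rightarrow> ('b \<Rightarrow> 'a) list \<Rightarrow> 'b \<Rightarrow> 'a" where
  "apply_unary f vs = (\<lambda>x. f (map (\<lambda>v. v x) vs))"

text \<open>
  For a monoid \<open>K\<close> this is the clone of polymorphisms of \<open>K\<close>, and its unary part is \<open>K\<close>. For the
  upper bound on the number of maximal clones only \<open>id \<in> K \<noteq> UNIV\<close> matters, because this already
  makes \<open>Pol K\<close> a proper clone.
\<close>

definition Pol :: "('a \<Rightarrow> 'a) set \<Rightarrow> 'a operation set" where
  "Pol K = {(n, f) \<in> operations. \<forall>vs. length vs = n \<and> set vs \<subseteq> K \<longrightarrow> apply_unary f vs \<in> K}"

lemma operations_iff: "(n, f) \<in> operations \<longleftrightarrow> n \<ge> 1 \<and> f \<in> extensional (tuples n)"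
  by (auto simp: operations_def PiE_def)

lemma unary_in_operations: "unary h \<in> operations"
  by (auto simp: unary_def operations_iff)

lemma apply_unary_unary: "apply_unary (\<lambda>xs\<in>tuples 1. h (xs ! 0)) [v] = h \<circ> v"
  by (auto simp: apply_unary_def tuples_def fun_eq_iff)

lemma compose_ops_in_operations:
  assumes "(n, f) \<in> operations" "length gs = n" "\<forall>g\<in>set gs. (m, g) \<in> operations"
  shows "compose_ops m f gs \<in> operations"
proof -
  have "gs \<noteq> []" using assms(1,2) by (auto simp: operations_iff)
  then have "m \<ge> 1" using assms(3) by (auto simp: operations_iff neq_Nil_conv)
  then show ?thesis by (simp add: compose_ops_def operations_iff)
qed

lemma projection_in_operations: "i < n \<Longrightarrow> projection n i \<in> operations"
  by (simp add: projection_def operations_iff)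

lemma clone_compose_ops:
  assumes "clone C" "(n, f) \<in> C" "length gs = n" "\<forall>g\<in>set gs. (m, g) \<in> C"
  shows "compose_ops m f gs \<in> C"
  using assms unfolding clone_def by blast

lemma apply_in_unary_part:
  assumes "clone C" "(n, f) \<in> C" "length vs = n" "set vs \<subseteq> unary_part C"
  shows "apply_unary f vs \<in> unary_part C"
proof -
  let ?gs = "map (\<lambda>v. \<lambda>xs\<in>tuples 1. v (xs ! 0)) vs"
  have "(1, g) \<in> C" if "g \<in> set ?gs" for g
    using that assms(4) by (auto simp: unary_part_def unary_def)
  then have "compose_ops 1 f ?gs \<in> C"
    using assms(1-3) unfolding clone_def by auto
  moreover have "compose_ops 1 f ?gs = unary (apply_unary f vs)"
    by (auto simp: compose_ops_def unary_def apply_unary_def fun_eq_iff comp_def cong: map_cong)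
  ultimately show ?thesis by (simp add: unary_part_def)
qed

lemma comp_in_unary_part:
  assumes "clone C" "h \<in> unary_part C" "v \<in> unary_part C"
  shows "h \<circ> v \<in> unary_part C"
  using apply_in_unary_part[OF assms(1), of 1 "\<lambda>xs\<in>tuples 1. h (xs ! 0)" "[v]"] assms(2,3)
  unfolding apply_unary_unary by (simp add: unary_part_def unary_def)

lemma clone_Pol: "clone (Pol K)"
  unfolding clone_def
proof (intro conjI allI impI)
  show "Pol K \<subseteq> operations" by (auto simp: Pol_def)
next
  fix n i :: nat assume "i < n"
  moreover from this have "apply_unary (\<lambda>xs\<in>tuples n. xs ! i) vs \<in> K" if "length vs = n" "set vs \<subseteq> K" for vs :: "('a \<Rightarrow> 'a) list"
  proof -
    have "apply_unary (\<lambda>xs\<in>tuples n. xs ! i) vs = vs ! i"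
      using that \<open>i < n\<close> by (auto simp: apply_unary_def tuples_def fun_eq_iff)
    then show ?thesis using that \<open>i < n\<close> by (simp add: subset_iff)
  qed
  ultimately show "projection n i \<in> Pol K"
    using projection_in_operations[of i n] by (auto simp: Pol_def projection_def)
next
  fix n m and f :: "'a list \<Rightarrow> 'a" and gs
  assume *: "(n, f) \<in> Pol K \<and> length gs = n \<and> (\<forall>g\<in>set gs. (m, g) \<in> Pol K)"
  have "apply_unary (\<lambda>xs\<in>tuples m. f (map (\<lambda>g. g xs) gs)) vs \<in> K" if vs: "length vs = m" "set vs \<subseteq> K" for vs
  proof -
    have "apply_unary (\<lambda>xs\<in>tuples m. f (map (\<lambda>g. g xs) gs)) vs = apply_unary f (map (\<lambda>g. apply_unary g vs) gs)"
      using vs by (auto simp: apply_unary_def tuples_def fun_eq_iff comp_def)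
    moreover have "set (map (\<lambda>g. apply_unary g vs) gs) \<subseteq> K" using * vs by (auto simp: Pol_def)
    ultimately show ?thesis using * unfolding Pol_def by auto
  qed
  moreover have "compose_ops m f gs \<in> operations"
    by (rule compose_ops_in_operations) (use * in \<open>auto simp: Pol_def\<close>)
  ultimately show "compose_ops m f gs \<in> Pol K"
    by (auto simp: Pol_def compose_ops_def)
qed

lemma unary_in_Pol: "unary h \<in> Pol K \<longleftrightarrow> (\<forall>v\<in>K. h \<circ> v \<in> K)"
proof
  assume *: "unary h \<in> Pol K"
  show "\<forall>v\<in>K. h \<circ> v \<in> K"
  proof
    fix v assume "v \<in> K"
    then have "length [v] = 1" "set [v] \<subseteq> K" by auto
    with * have "apply_unary (\<lambda>xs\<in>tuples 1. h (xs ! 0)) [v] \<in> K" unfolding Pol_def unary_def by blast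
    then show "h \<circ> v \<in> K" unfolding apply_unary_unary .
  qed
next
  assume *: "\<forall>v\<in>K. h \<circ> v \<in> K"
  have "apply_unary (\<lambda>xs\<in>tuples 1. h (xs ! 0)) vs \<in> K" if vs: "length vs = 1" "set vs \<subseteq> K" for vs
  proof -
    obtain v where "vs = [v]" using vs(1) by (cases vs) auto
    then have "v \<in> K" using vs(2) by simp
    with * \<open>vs = [v]\<close> show ?thesis by (simp only: apply_unary_unary)
  qed
  then show "unary h \<in> Pol K" using unary_in_operations[of h] by (auto simp: Pol_def unary_def)
qed

lemma Pol_neq_operations:
  assumes "id \<in> K" "K \<noteq> UNIV"
  shows "Pol K \<noteq> operations"
proof -
  obtain h where "h \<notin> K" using assms(2) by blast
  then have "unary h \<notin> Pol K" using assms(1) unfolding unary_in_Pol by (metis comp_id)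
  then show ?thesis using unary_in_operations by metis
qed

lemma maximal_clone_eq:
  assumes "maximal_clone C" "clone E" "E \<noteq> operations" "C \<subseteq> E"
  shows "C = E"
  using assms unfolding maximal_clone_def clone_def by blast

lemma not_in_PolE:
  assumes "clone C" "\<not> C \<subseteq> Pol K"
  obtains n f gs where "(n, f) \<in> C" "length gs = n" "set gs \<subseteq> K" "apply_unary f gs \<notin> K"
proof -
  obtain t where t: "t \<in> C" "t \<notin> Pol K" using assms(2) by blast
  obtain n f where nf: "t = (n, f)" by (cases t)
  with t have "(n, f) \<in> operations" using assms(1) unfolding clone_def by blast
  with t nf obtain gs where "length gs = n" "set gs \<subseteq> K" "apply_unary f gs \<notin> K" unfolding Pol_def by blast
  with t nf that show ?thesis by blast
qed

context regular_universe begin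

section \<open>Thinning out domains by pigeonhole\<close>

definition no_large_fibre :: "('a \<Rightarrow> 'a) set" where
  "no_large_fibre = {g. \<forall>y. small (g -` {y})}"

definition few_large_fibres :: "('a \<Rightarrow> 'a) set" where
  "few_large_fibres = {g. small {y. \<not> small (g -` {y})}}"

lemma pigeonhole_large:
  assumes "small I" "\<not> small (\<Union>i\<in>I. A i)"
  shows "\<exists>i\<in>I. \<not> small (A i)"
  using small_UN assms by blast

text \<open>Each \<open>g\<close> cuts the domain into fewer than \<open>|U|\<close> pieces: one for
  each value with a large fibre, where \<open>g\<close> is constant, and a remainder where its
  fibres are small. For each \<open>y\<close> some piece keeps the fibre of \<open>h\<close> large;
  by a second pigeonhole, one piece does so for a large set of \<open>y\<close>.\<close>

lemma refine_fibres:
  fixes h :: "'c \<Rightarrow> 'e" and gs :: "('c \<Rightarrow> 'd) list"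
  assumes "\<forall>g\<in>set gs. small {y. \<not> small (g -` {y})}"
    and "\<not> small Z" "\<forall>y\<in>Z. \<not> small {x\<in>H. h x = y}"
  shows "\<exists>H' Z'. H' \<subseteq> H \<and> Z' \<subseteq> Z \<and> \<not> small Z' \<and> (\<forall>y\<in>Z'. \<not> small {x\<in>H'. h x = y}) \<and>
    (\<forall>g\<in>set gs. (\<forall>y. small {x\<in>H'. g x = y}) \<or> (\<exists>b. \<forall>x\<in>H'. g x = b))"
  using assms(1)
proof (induction gs)
  case Nil
  with assms(2,3) show ?case by (intro exI[of _ H] exI[of _ Z]) auto
next
  case (Cons g gs)
  then obtain H' Z' where H': "H' \<subseteq> H" "Z' \<subseteq> Z" "\<not> small Z'" "\<forall>y\<in>Z'. \<not> small {x\<in>H'. h x = y}"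
    "\<forall>g\<in>set gs. (\<forall>y. small {x\<in>H'. g x = y}) \<or> (\<exists>b. \<forall>x\<in>H'. g x = b)" by auto
  define B where "B = {y. \<not> small (g -` {y})}"
  have B: "small B" using Cons.prems by (simp add: B_def)
  define J where "J = insert None (Some ` B)"
  have J: "small J" unfolding J_def using small_Un[OF small_finite[of "{None}"] small_image[OF B]] by simp
  define P where "P j = (case j of None \<Rightarrow> {x\<in>H'. g x \<notin> B} | Some b \<Rightarrow> {x\<in>H'. g x = b})" for j
  have P: "H' = (\<Union>j\<in>J. P j)" unfolding J_def P_def by auto
  have "\<exists>j\<in>J. \<not> small {x\<in>P j. h x = y}" if "y \<in> Z'" for y
  proof (rule pigeonhole_large[OF J])
    have "{x\<in>H'. h x = y} = (\<Union>j\<in>J. {x\<in>P j. h x = y})" using P by auto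
    then show "\<not> small (\<Union>j\<in>J. {x\<in>P j. h x = y})" using H'(4) that by auto
  qed
  then have "Z' = (\<Union>j\<in>J. {y\<in>Z'. \<not> small {x\<in>P j. h x = y}})" by auto
  then obtain j where j: "j \<in> J" "\<not> small {y\<in>Z'. \<not> small {x\<in>P j. h x = y}}"
    using pigeonhole_large[OF J, of "\<lambda>j. {y\<in>Z'. \<not> small {x\<in>P j. h x = y}}"] H'(3) by auto
  have sub: "P j \<subseteq> H'" unfolding P_def by (auto split: option.splits)
  have new: "(\<forall>y. small {x\<in>P j. g x = y}) \<or> (\<exists>b. \<forall>x\<in>P j. g x = b)"
  proof (cases j)
    case None
    have "small {x\<in>P j. g x = y}" for y
    proof (cases "y \<in> B")
      case True
      then have "{x\<in>P j. g x = y} = {}" using None by (auto simp: P_def)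
      then show ?thesis by (simp only: small_empty)
    next
      case False
      then have "small (g -` {y})" by (simp add: B_def)
      then show ?thesis by (rule small_mono[rotated]) auto
    qed
    then show ?thesis by blast
  next
    case (Some b)
    then show ?thesis by (auto simp: P_def)
  qed
  have old: "(\<forall>y. small {x\<in>P j. g x = y}) \<or> (\<exists>b. \<forall>x\<in>P j. g x = b)" if "g \<in> set gs" for g
  proof (cases "\<forall>y. small {x\<in>H'. g x = y}")
    case True
    have "small {x\<in>P j. g x = y}" for y
      by (rule small_mono[OF _ True[rule_format, of y]]) (use sub in auto)
    then show ?thesis by blast
  next
    case False
    then show ?thesis using H'(5) that sub by blast
  qed
  show ?case
    using H'(1,2) j sub new old
    by (intro exI[of _ "P j"] exI[of _ "{y\<in>Z'. \<not> small {x\<in>P j. h x = y}}"]) auto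
qed

end

section \<open>The unary part of a clone containing the permutations\<close>

locale perm_clone = regular_universe U for U :: "'a set" +
  fixes C :: "'a operation set"
  assumes clone: "clone C"
    and perms: "bij p \<Longrightarrow> unary p \<in> C"
begin

abbreviation "M \<equiv> unary_part C"

lemma M_perm: "bij p \<Longrightarrow> p \<in> M"
  using perms by (simp add: unary_part_def)

lemmas M_app = apply_in_unary_part[OF clone]
lemmas M_comp = comp_in_unary_part[OF clone]

text \<open>
  The domain is thinned out to a set \<open>W\<close>, with large complement, on which every inner function is
  injective with colarge image or constant. There it agrees with a permutation or with a member of
  \<open>M\<close> that has a large fibre.
\<close>

lemma realise_fibres:
  fixes gs :: "('a \<Rightarrow> 'a) list"
  assumes f: "(n, f) \<in> C" "length gs = n"
    and Z: "Z \<noteq> {}" "\<forall>y\<in>Z. \<not> small {x\<in>H. apply_unary f gs x = y}"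
    and gs: "\<forall>g\<in>set gs. (\<forall>y. small {x\<in>H. g x = y}) \<or>
      (\<exists>b. \<forall>x\<in>H. g x = b) \<and> (\<exists>u\<in>M. \<exists>c. \<not> small (u -` {c}))"
  shows "\<exists>u\<in>M. \<forall>y\<in>Z. \<not> small (u -` {y})"
proof -
  \<comment> \<open>The identity makes the choice itself injective and the complement of
    \<open>W True\<close> large.\<close>
  define G where "G = insert id {g\<in>set gs. \<forall>y. small {x\<in>H. g x = y}}"
  have G: "finite G" "\<forall>g\<in>G. \<forall>y. small {x\<in>H. g x = y}"
    unfolding G_def by (auto intro: small_finite)
  \<comment> \<open>The middle coordinate gives each \<open>y\<close> a large set of chosen points.
    The Boolean separates the domain \<open>W True\<close> from a reserve that keeps the complements
    of \<open>W True\<close> and of its images large.\<close>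
  define I where "I = Z \<times> (UNIV :: 'a set) \<times> (UNIV :: bool set)"
  have "|I| \<le>o |U|"
    unfolding I_def by (intro card_of_Times_le_U card_of_le_U finite_le_U) simp
  moreover have "\<exists>t\<in>{x\<in>H. apply_unary f gs x = fst i}. \<forall>g\<in>G. \<forall>d\<in>D. g t \<noteq> g d"
    if "i \<in> I" "small D" for i and D :: "'a set"
  proof -
    have "small (\<Union>g\<in>G. \<Union>d\<in>D. {x\<in>H. g x = g d})"
      using G that(2) by (intro small_UN) (auto simp: small_finite)
    then have "\<not> small ({x\<in>H. apply_unary f gs x = fst i} - (\<Union>g\<in>G. \<Union>d\<in>D. {x\<in>H. g x = g d}))"
      using Z(2) that(1) by (intro not_small_Diff) (auto simp: I_def)
    then have "{x\<in>H. apply_unary f gs x = fst i} - (\<Union>g\<in>G. \<Union>d\<in>D. {x\<in>H. g x = g d}) \<noteq> {}"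
      using small_finite by fastforce
    then show ?thesis by blast
  qed
  ultimately obtain e where e: "\<forall>i\<in>I. e i \<in> {x\<in>H. apply_unary f gs x = fst i}" "\<forall>g\<in>G. inj_on (g \<circ> e) I"
    using greedy_choice[of I "\<lambda>i. {x\<in>H. apply_unary f gs x = fst i}" G] by blast
  have e_inj: "inj_on e I" using e(2) unfolding G_def by auto
  define W where "W b = e ` (Z \<times> UNIV \<times> {b})" for b
  have W_sub: "W b \<subseteq> H" for b using e(1) unfolding W_def I_def by auto
  have large_e: "\<not> small ((g \<circ> e) ` ({y} \<times> UNIV \<times> {b}))" if "g \<in> G" "y \<in> Z" for g y b
  proof -
    have "inj_on (g \<circ> e) ({y} \<times> UNIV \<times> {b})"
      by (rule inj_on_subset[OF e(2)[rule_format, OF that(1)]]) (use that in \<open>auto simp: I_def\<close>)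
    then show ?thesis
      by (simp only: small_image_iff) (intro not_small_Times not_small_U, auto)
  qed
  have disj: "g ` W False \<subseteq> - g ` W True" if "g \<in> G" for g
  proof -
    have "(g \<circ> e) ` (Z \<times> UNIV \<times> {False} \<inter> Z \<times> UNIV \<times> {True}) =
        (g \<circ> e) ` (Z \<times> UNIV \<times> {False}) \<inter> (g \<circ> e) ` (Z \<times> UNIV \<times> {True})"
      by (rule inj_on_image_Int[OF e(2)[rule_format, OF that]]) (auto simp: I_def)
    moreover have "Z \<times> (UNIV :: 'a set) \<times> {False} \<inter> Z \<times> UNIV \<times> {True} = {}" by blast
    ultimately have "g ` W False \<inter> g ` W True = {}" unfolding W_def by (simp add: image_comp)
    then show ?thesis by blast
  qed
  have large: "\<not> small (- g ` W True)" if "g \<in> G" for g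
  proof -
    obtain y where "y \<in> Z" using Z(1) by blast
    moreover have "(g \<circ> e) ` ({y} \<times> UNIV \<times> {False}) \<subseteq> - g ` W True"
      using disj[OF that] \<open>y \<in> Z\<close> unfolding W_def by (auto simp: image_subset_iff)
    ultimately show ?thesis using large_e[OF that] small_mono by blast
  qed
  have large_W: "\<not> small (- W True)" using large[of id] by (simp add: G_def)
  have "\<exists>v\<in>M. \<forall>x\<in>W True. v x = g x" if g: "g \<in> set gs" for g
  proof (cases "g \<in> G")
    case True
    have "inj_on g (W True)"
      unfolding W_def
      by (rule inj_on_imageI[OF inj_on_subset[OF e(2)[rule_format, OF True]]]) (use Z in \<open>auto simp: I_def\<close>)
    then show ?thesis using ex_perm_extending[OF _ large_W large[OF True]] M_perm by blast
  next
    case False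
    then obtain b u c where b: "\<forall>x\<in>H. g x = b" and u: "u \<in> M" "\<not> small (u -` {c})"
      using False gs g unfolding G_def by blast
    \<comment> \<open>\<open>p\<close> moves \<open>W True\<close> into one large fibre and
      \<open>q\<close> corrects the value, so one member of \<open>M\<close> with a large fibre
      imitates every constant.\<close>
    obtain p where p: "bij p" "p ` W True \<subseteq> u -` {c}" using ex_perm_into[OF large_W u(2)] by blast
    obtain q where q: "bij q" "q c = b"
      using ex_perm_extending[of "\<lambda>_. b" "{c}"] not_small_Compl by (auto simp: small_finite)
    have "q \<circ> u \<circ> p \<in> M" using M_comp M_perm p q u by blast
    moreover have "\<forall>x\<in>W True. (q \<circ> u \<circ> p) x = g x" using p q b W_sub by fastforce
    ultimately show ?thesis by blast
  qed
  then obtain V where V: "\<And>g. g \<in> set gs \<Longrightarrow> V g \<in> M" "\<And>g x. g \<in> set gs \<Longrightarrow> x \<in> W True \<Longrightarrow> V g x = g x"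
    by metis
  define u where "u = apply_unary f (map V gs)"
  have "u \<in> M" unfolding u_def using f V by (intro M_app) auto
  moreover have "\<not> small (u -` {y})" if "y \<in> Z" for y
  proof -
    have "u x = apply_unary f gs x" if "x \<in> W True" for x
      unfolding u_def apply_unary_def using V that by (auto simp: comp_def cong: map_cong)
    then have "(id \<circ> e) ` ({y} \<times> UNIV \<times> {True}) \<subseteq> u -` {y}"
      using e(1) that unfolding W_def I_def by auto
    then show ?thesis using large_e[of id y True] that small_mono unfolding G_def by blast
  qed
  ultimately show ?thesis by blast
qed

text \<open>All inner functions have small fibres, so the constant case of
  \<open>realise_fibres\<close> does not arise; the result makes that case available
  afterwards.\<close>

lemma ex_large_fibre:
  assumes "\<not> C \<subseteq> Pol no_large_fibre"
  shows "\<exists>u\<in>M. \<exists>c. \<not> small (u -` {c})"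
proof -
  obtain n f gs where f: "(n, f) \<in> C" "length gs = n" "set gs \<subseteq> no_large_fibre" "apply_unary f gs \<notin> no_large_fibre"
    using assms not_in_PolE clone by metis
  then obtain y where "\<not> small (apply_unary f gs -` {y})" unfolding no_large_fibre_def by blast
  then have "\<forall>z\<in>{y}. \<not> small {x\<in>UNIV. apply_unary f gs x = z}" by (simp add: vimage_def)
  moreover have "\<forall>g\<in>set gs. \<forall>z. small {x\<in>UNIV. g x = z}"
    using f(3) by (auto simp: no_large_fibre_def vimage_def)
  ultimately have "\<exists>u\<in>M. \<forall>z\<in>{y}. \<not> small (u -` {z})"
    by (intro realise_fibres[OF f(1,2)]) blast+
  then show ?thesis by blast
qed

text \<open>Thinning out by \<open>refine_fibres\<close> may turn inner functions into constants,
  which is why a member of \<open>M\<close> with a large fibre must be found first.\<close>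

lemma ex_large_fibres:
  assumes "\<not> C \<subseteq> Pol few_large_fibres" "\<not> C \<subseteq> Pol no_large_fibre"
  shows "\<exists>u\<in>M. \<not> small {y. \<not> small (u -` {y})}"
proof -
  obtain n f gs where f: "(n, f) \<in> C" "length gs = n" "set gs \<subseteq> few_large_fibres" "apply_unary f gs \<notin> few_large_fibres"
    using assms(1) not_in_PolE clone by metis
  define Z where "Z = {y. \<not> small (apply_unary f gs -` {y})}"
  have "\<not> small Z" using f(4) by (simp add: few_large_fibres_def Z_def)
  moreover have "\<forall>y\<in>Z. \<not> small {x\<in>UNIV. apply_unary f gs x = y}"
    unfolding Z_def vimage_def by simp
  moreover have "\<forall>g\<in>set gs. small {y. \<not> small (g -` {y})}" using f(3) by (auto simp: few_large_fibres_def)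
  ultimately obtain H' Z' where H': "Z' \<subseteq> Z" "\<not> small Z'" "\<forall>y\<in>Z'. \<not> small {x\<in>H'. apply_unary f gs x = y}"
    "\<forall>g\<in>set gs. (\<forall>y. small {x\<in>H'. g x = y}) \<or> (\<exists>b. \<forall>x\<in>H'. g x = b)"
    using refine_fibres[of gs Z UNIV "apply_unary f gs"] by blast
  have "Z' \<noteq> {}" using H'(2) small_finite by blast
  with realise_fibres[OF f(1,2) _ H'(3)] H'(4) ex_large_fibre[OF assms(2)]
  obtain u where u: "u \<in> M" "\<forall>y\<in>Z'. \<not> small (u -` {y})" by blast
  then have "Z' \<subseteq> {y. \<not> small (u -` {y})}" by blast
  with u H'(2) show ?thesis using small_mono by blast
qed

text \<open>
  The function is \<open>u \<circ> p \<circ> u\<close> for a permutation \<open>p\<close> mapping points with large \<open>u\<close>-fibre onto a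
  transversal of \<open>u\<close>.
\<close>

lemma ex_full_same_range:
  assumes "u \<in> M" "\<not> small {y. \<not> small (u -` {y})}"
  shows "\<exists>w\<in>M. full w \<and> range w = range u"
proof -
  define Y where "Y = {y. \<not> small (u -` {y})}"
  define T where "T = inv u ` range u"
  have uT: "u (inv u y) = y" if "y \<in> range u" for y using that by (simp add: f_inv_into_f)
  have large_Y: "\<not> small Y" using assms(2) by (simp add: Y_def)
  then obtain y0 where "y0 \<in> Y" by (metis all_not_in_conv small_empty)
  \<comment> \<open>The transversal meets this large fibre in one point only, so its complement is
    large.\<close>
  have "\<not> small (u -` {y0} - {inv u y0})"
    using \<open>y0 \<in> Y\<close> by (intro not_small_Diff) (auto simp: Y_def small_finite)
  moreover have "u -` {y0} - {inv u y0} \<subseteq> - T" unfolding T_def using uT by auto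
  ultimately have large_T: "\<not> small (- T)" using small_mono by blast
  obtain B where B: "B \<subseteq> Y" "|B| =o |T|" "\<not> small (Y - B)"
    using subset_of_card[OF large_Y card_of_le_U, of T] by blast
  obtain k where k: "bij_betw k B T" using B(2) unfolding card_of_ordIso[symmetric] by blast
  have "\<not> small (- B)" using B(3) small_mono[of "Y - B" "- B"] by blast
  then obtain p where p: "bij p" "\<forall>x\<in>B. p x = k x"
    using ex_perm_extending[of k B] k large_T by (auto simp: bij_betw_def)
  define w where "w = u \<circ> p \<circ> u"
  have w_fibre: "\<not> small (w -` {y})" if "y \<in> range u" for y
  proof -
    have "inv u y \<in> k ` B" using that k by (simp add: bij_betw_def T_def)
    then obtain b where b: "b \<in> B" "k b = inv u y" by auto
    then have "u -` {b} \<subseteq> w -` {y}" using p uT[OF that] unfolding w_def by auto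
    moreover have "\<not> small (u -` {b})" using b B(1) by (auto simp: Y_def)
    ultimately show ?thesis using small_mono by blast
  qed
  have "range w = range u"
  proof
    show "range w \<subseteq> range u" unfolding w_def by auto
    show "range u \<subseteq> range w"
    proof
      fix y assume "y \<in> range u"
      then have "w -` {y} \<noteq> {}" using w_fibre by (metis small_empty)
      then show "y \<in> range w" by auto
    qed
  qed
  moreover from this have "full w" using w_fibre by (simp add: full_def)
  moreover have "w \<in> M" unfolding w_def using M_comp M_perm assms(1) p(1) by blast
  ultimately show ?thesis by blast
qed

lemma full_in_M:
  assumes "u \<in> M" "full u" "full w" "|range u| =o |range w|" "|- range u| =o |- range w|"
  shows "w \<in> M"
  using full_equiv[OF assms(2-5)] M_comp M_perm assms(1) by blast

lemma full_large_range_in_M: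
  assumes "u \<in> M" "full u" "full w" "\<not> small (range u)" "\<not> small (range w)"
    "|- range u| =o |- range w|"
  shows "w \<in> M"
proof (rule full_in_M[OF assms(1-3) _ assms(6)])
  show "|range u| =o |range w|"
    using ex_bij_large[OF assms(4) card_of_le_U assms(5) card_of_le_U] card_of_ordIso by blast
qed

end

text \<open>
  The monoid usually written \<open>G\<^sub>\<lambda>\<close>, where \<open>\<lambda>\<close> is the cardinality of \<open>D\<close>. Only this cardinality
  matters; indexing by sets avoids fixing representatives of cardinals.
\<close>

definition G_set :: "'a set \<Rightarrow> ('a \<Rightarrow> 'a) set" where
  "G_set D = {u. \<forall>B. |B| =o |D| \<longrightarrow> |D| \<le>o |- u ` (- B)|}"

definition slice_image :: "nat \<Rightarrow> ('a list \<Rightarrow> 'a) \<Rightarrow> nat \<Rightarrow> 'a \<Rightarrow> 'a set" where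
  "slice_image n f k c = f ` {xs. length xs = n \<and> xs ! k = c}"

definition constants :: "('a \<Rightarrow> 'a) set" where
  "constants = range (\<lambda>c x. c)"

context regular_universe begin

text \<open>The parameter lets one argument run twice: with \<open>Q\<close> empty it leads to the
  constants in \<open>M\<close>, and with \<open>Q = constants\<close> it may then use them.\<close>

definition nearly_onto_or :: "('a \<Rightarrow> 'a) set \<Rightarrow> ('a \<Rightarrow> 'a) set" where
  "nearly_onto_or Q = Q \<union> {u. small (- range u)}"

lemma ex_subset_card_colarge:
  fixes E :: "'a set"
  assumes "|D| \<le>o |E|"
  shows "\<exists>D'\<subseteq>E. |D'| =o |D| \<and> \<not> small (- D')"
proof (cases "small D")
  case True
  obtain D' where D': "D' \<subseteq> E" "|D| =o |D'|"
    using internalize_card_of_ordLeq2[THEN iffD1, OF assms] by blast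
  then have "small D'" using True small_ordLeq ordIso_symmetric ordIso_imp_ordLeq by blast
  then show ?thesis using D' not_small_Compl ordIso_symmetric by blast
next
  case False
  then have "\<not> small E" using small_ordLeq assms by blast
  moreover have "|D| \<le>o |U|" using assms card_of_le_U ordLeq_transitive by blast
  ultimately obtain D' where "D' \<subseteq> E" "|D'| =o |D|" "\<not> small (E - D')"
    using subset_of_card by blast
  then show ?thesis using small_mono[of "E - D'" "- D'"] by blast
qed

lemma tuple_choice:
  assumes I: "|I| \<le>o |U|" and F: "small F"
    and slices: "\<forall>i\<in>I. \<not> small (slice_image n f (k i) (c i))"
  shows "\<exists>t. (\<forall>i\<in>I. length (t i) = n \<and> t i ! k i = c i \<and> f (t i) \<notin> F) \<and> inj_on (f \<circ> t) I"
proof -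
  define H where "H i = {xs. length xs = n \<and> xs ! k i = c i \<and> f xs \<notin> F}" for i
  have "\<exists>t\<in>H i. \<forall>g\<in>{f}. \<forall>d\<in>D. g t \<noteq> g d" if "i \<in> I" "small D" for i D
  proof -
    have "\<not> small (slice_image n f (k i) (c i) - (F \<union> f ` D))"
      using slices that F by (intro not_small_Diff small_Un small_image) auto
    then have "slice_image n f (k i) (c i) - (F \<union> f ` D) \<noteq> {}" by (metis small_empty)
    then show ?thesis unfolding slice_image_def H_def by blast
  qed
  from greedy_choice[OF I this] show ?thesis unfolding H_def by auto
qed

end

section \<open>Full surjections and functions with colarge range\<close>

context perm_clone begin

text \<open>
  Choose a function in \<open>M\<close> with only large nonempty fibres whose range has a complement \<open>D\<close> of
  least cardinality. If \<open>D\<close> is not empty, then a witness of \<open>\<not> C \<subseteq> Pol (G_set D)\<close> can be modified so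
  that its inner functions miss exactly \<open>|D|\<close> points, hence lie in \<open>M\<close>, while its value still misses
  fewer than \<open>|D|\<close> points.
\<close>

lemma ex_full_surj_in_M:
  assumes "\<not> C \<subseteq> Pol few_large_fibres" "\<not> C \<subseteq> Pol no_large_fibre" "\<And>D. D \<noteq> {} \<Longrightarrow> \<not> C \<subseteq> Pol (G_set D)"
  shows "\<exists>w\<in>M. full w \<and> range w = UNIV"
proof -
  have from_large: "\<exists>w\<in>M. full w \<and> \<not> small (range w) \<and> range w = range u"
    if u: "u \<in> M" "\<not> small {y. \<not> small (u -` {y})}" for u
  proof -
    obtain w where w: "w \<in> M" "full w" "range w = range u" using ex_full_same_range[OF u] by blast
    have "{y. \<not> small (u -` {y})} \<subseteq> range u"
    proof
      fix y assume "y \<in> {y. \<not> small (u -` {y})}"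
      then have "u -` {y} \<noteq> {}" using small_empty by (metis mem_Collect_eq)
      then show "y \<in> range u" by auto
    qed
    then have "\<not> small (range u)" using u(2) small_mono by blast
    with w show ?thesis by auto
  qed
  define R where "R = {w \<in> M. full w \<and> \<not> small (range w)}"
  obtain u where "u \<in> M" "\<not> small {y. \<not> small (u -` {y})}" using ex_large_fibres[OF assms(1,2)] by blast
  then have "R \<noteq> {}" using from_large unfolding R_def by blast
  then obtain w where w: "w \<in> R" "\<forall>w'\<in>R. |- range w| \<le>o |- range w'|"
    using exists_minim_Card_order[of "(\<lambda>w. |- range w| ) ` R"] card_of_Card_order by auto
  define D where "D = - range w"
  have "D = {}"
  proof (rule ccontr)
    assume "D \<noteq> {}"
    then obtain n f gs where f: "(n, f) \<in> C" "length gs = n" "set gs \<subseteq> G_set D" "apply_unary f gs \<notin> G_set D"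
      using assms(3) not_in_PolE clone by metis
    then obtain B where B: "|B| =o |D|" "\<not> |D| \<le>o |- apply_unary f gs ` (- B)|" unfolding G_set_def by blast
    have less: "|- apply_unary f gs ` (- B)| <o |D|"
      using B(2) by (simp add: not_ordLeq_iff_ordLess card_of_Well_order)
    have "\<exists>D'. D' \<subseteq> - g ` (- B) \<and> |D'| =o |D| \<and> \<not> small (- D')" if "g \<in> set gs" for g
    proof -
      have "|D| \<le>o |- g ` (- B)|" using that f(3) B(1) unfolding G_set_def by blast
      then show ?thesis using ex_subset_card_colarge by blast
    qed
    then obtain Dg where Dg: "\<And>g. g \<in> set gs \<Longrightarrow> Dg g \<subseteq> - g ` (- B)"
      "\<And>g. g \<in> set gs \<Longrightarrow> |Dg g| =o |D|" "\<And>g. g \<in> set gs \<Longrightarrow> \<not> small (- Dg g)"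
      by metis
    obtain w0 :: "'a \<Rightarrow> 'a \<times> bool" where w0: "range w0 = UNIV" "full w0"
      using ex_full_surj_UNIV[of "UNIV :: ('a \<times> bool) set"]
        card_of_Times_le_U[OF card_of_le_U[of UNIV] finite_le_U[of "UNIV :: bool set"]] by auto
    \<comment> \<open>The pairs \<open>(a, True)\<close> with \<open>a\<close> outside
      \<open>B\<close> reproduce \<open>g\<close>, which avoids \<open>Dg g\<close> there. The pairs
      \<open>(a, False)\<close> fill up \<open>- Dg g\<close>, and the chosen point is a default
      inside it, so the range is exactly \<open>- Dg g\<close>.\<close>
    define \<phi> where "\<phi> g p = (if snd p \<and> fst p \<notin> B then g (fst p)
      else if fst p \<notin> Dg g then fst p else (SOME d. d \<notin> Dg g))" for g :: "'a \<Rightarrow> 'a" and p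
    have "\<phi> g \<circ> w0 \<in> M" if g: "g \<in> set gs" for g
    proof -
      have "- Dg g \<noteq> {}" using Dg(3)[OF g] by (metis small_empty)
      then have some: "(SOME d. d \<notin> Dg g) \<notin> Dg g" by (metis ComplD all_not_in_conv someI)
      have "range (\<phi> g) = - Dg g"
      proof
        show "range (\<phi> g) \<subseteq> - Dg g" using Dg(1)[OF g] some unfolding \<phi>_def by auto
        show "- Dg g \<subseteq> range (\<phi> g)"
        proof
          fix a assume "a \<in> - Dg g"
          then have "\<phi> g (a, False) = a" unfolding \<phi>_def by auto
          then show "a \<in> range (\<phi> g)" by (metis rangeI)
        qed
      qed
      then have r: "range (\<phi> g \<circ> w0) = - Dg g" using w0(1) by (metis image_comp)
      show ?thesis
      proof (rule full_large_range_in_M[of w])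
        show "w \<in> M" "full w" "\<not> small (range w)" using w(1) by (auto simp: R_def)
        show "full (\<phi> g \<circ> w0)" using w0(2) by (rule full_comp)
        show "\<not> small (range (\<phi> g \<circ> w0))" using r Dg(3)[OF g] by simp
        show "|- range w| =o |- range (\<phi> g \<circ> w0)|"
          using ordIso_symmetric[OF Dg(2)[OF g]] unfolding r D_def by simp
      qed
    qed
    then have h': "apply_unary f (map (\<lambda>g. \<phi> g \<circ> w0) gs) \<in> M" (is "?h \<in> M")
      using f by (intro M_app) auto
    have hx: "?h x = apply_unary f gs a" if "w0 x = (a, True)" "a \<notin> B" for x a
      using that by (simp add: apply_unary_def \<phi>_def comp_def)
    have fib: "\<not> small (?h -` {z})" if z: "z \<in> apply_unary f gs ` (- B)" for z
    proof -
      obtain a where a: "a \<notin> B" "z = apply_unary f gs a" using z by auto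
      then have "w0 -` {(a, True)} \<subseteq> ?h -` {z}" using hx by auto
      moreover have "\<not> small (w0 -` {(a, True)})" using w0 unfolding full_def by auto
      ultimately show ?thesis using small_mono by blast
    qed
    have "small (- apply_unary f gs ` (- B))"
      unfolding small_def using less card_of_le_U ordLess_ordLeq_trans by blast
    from not_small_Compl[OF this] have "\<not> small (apply_unary f gs ` (- B))" by simp
    then have "\<not> small {y. \<not> small (?h -` {y})}" using fib small_mono[of "apply_unary f gs ` (- B)" "{y. \<not> small (?h -` {y})}"] by blast
    then obtain w' where w': "w' \<in> M" "full w'" "\<not> small (range w')" "range w' = range ?h"
      using from_large[OF h'] by blast
    have "apply_unary f gs ` (- B) \<subseteq> range ?h"
    proof
      fix z assume "z \<in> apply_unary f gs ` (- B)"
      then have "?h -` {z} \<noteq> {}" using fib by (metis small_empty)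
      then show "z \<in> range ?h" by auto
    qed
    then have "- range w' \<subseteq> - apply_unary f gs ` (- B)" using w'(4) by auto
    then have "|- range w'| <o |D|" using less card_of_mono1 ordLeq_ordLess_trans by blast
    moreover have "|D| \<le>o |- range w'|" using w(2) w' unfolding D_def R_def by blast
    ultimately show False using not_ordLess_ordLeq by blast
  qed
  then show ?thesis using w(1) by (auto simp: D_def R_def)
qed

lemma surj_full_in_M:
  assumes "\<exists>w\<in>M. full w \<and> range w = UNIV" "full v" "range v = UNIV"
  shows "v \<in> M"
  using assms full_in_M card_of_refl by metis

text \<open>The values of \<phi> off the range of \<open>u\<close> do not affect the composite. This
  set is large, so \<phi> can be changed there to take every value on a large set, which makes it a
  full surjection.\<close>

lemma comp_in_M:
  assumes N: "\<exists>w\<in>M. full w \<and> range w = UNIV"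
    and u: "u \<in> M" "\<not> small (- range u)"
  shows "\<phi> \<circ> u \<in> M"
proof -
  obtain s :: "'a \<Rightarrow> 'a" where s: "s ` (- range u) = UNIV" "\<forall>y. \<not> small {x\<in>- range u. s x = y}"
    using ex_full_surj[OF u(2) card_of_le_U UNIV_not_empty card_of_le_U] by auto
  define w where "w x = (if x \<in> range u then \<phi> x else s x)" for x
  have "\<not> small (w -` {y})" for y
  proof -
    have "{x\<in>- range u. s x = y} \<subseteq> w -` {y}" unfolding w_def by auto
    then show ?thesis using s(2) small_mono by blast
  qed
  then have "full w" unfolding full_def by blast
  moreover have "range w = UNIV"
  proof -
    have "s ` (- range u) \<subseteq> range w" unfolding w_def by (auto simp: image_iff)
    then show ?thesis using s(1) by auto
  qed
  ultimately have "w \<in> M" by (rule surj_full_in_M[OF N])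
  moreover have "\<phi> \<circ> u = w \<circ> u" unfolding w_def by auto
  ultimately show ?thesis using M_comp u(1) by simp
qed

lemma inj_imp_M_UNIV:
  assumes N: "\<exists>w\<in>M. full w \<and> range w = UNIV"
    and u: "u \<in> M" "\<not> small (- range u)" "inj u"
  shows "M = UNIV"
proof -
  have "g \<in> M" for g
  proof -
    have "g = (g \<circ> inv u) \<circ> u" using u(3) by (auto simp: fun_eq_iff)
    then show ?thesis using comp_in_M[OF N u(1,2), of "g \<circ> inv u"] by simp
  qed
  then show ?thesis by auto
qed

text \<open>Inner functions in \<open>Q\<close> remain in \<open>M\<close> after precomposition; the
  others are nearly onto and are completed to surjections. The completion adds only a small set to
  the range of the composite, which thus stays colarge. The \<open>h\<close> of the conclusion is
  the original composite.\<close>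

lemma ex_colarge_range:
  assumes N: "\<exists>w\<in>M. full w \<and> range w = UNIV"
    and Q: "Q \<subseteq> M" "\<And>g k. g \<in> Q \<Longrightarrow> g \<circ> k \<in> Q"
    and K: "\<not> C \<subseteq> Pol (nearly_onto_or Q)"
  shows "\<exists>u\<in>M. full u \<and> \<not> small (- range u) \<and> (\<exists>h. h \<notin> Q \<and> range h \<subseteq> range u)"
proof -
  obtain n f gs where f: "(n, f) \<in> C" "length gs = n" "set gs \<subseteq> nearly_onto_or Q" "apply_unary f gs \<notin> nearly_onto_or Q"
    using K not_in_PolE clone by metis
  obtain w0 :: "'a \<Rightarrow> 'a \<times> bool" where w0: "range w0 = UNIV" "full w0"
    using ex_full_surj_UNIV[of "UNIV :: ('a \<times> bool) set"]
      card_of_Times_le_U[OF card_of_le_U[of UNIV] finite_le_U[of "UNIV :: bool set"]] by auto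
  \<comment> \<open>The \<open>True\<close> half repeats \<open>g\<close>; the \<open>False\<close>
    half departs from \<open>g\<close> only at points outside its range, which it adds as
    values.\<close>
  define \<phi> where "\<phi> g p = (if snd p \<or> g \<in> Q \<or> fst p \<in> range g then g (fst p) else fst p)"
    for g :: "'a \<Rightarrow> 'a" and p
  have M: "\<phi> g \<circ> w0 \<in> M" if g: "g \<in> set gs" for g
  proof (cases "g \<in> Q")
    case True
    then have "\<phi> g \<circ> w0 = g \<circ> (fst \<circ> w0)" by (auto simp: \<phi>_def)
    then show ?thesis using Q True by auto
  next
    case False
    have "range (\<phi> g) = UNIV"
    proof -
      have "y \<in> range (\<phi> g)" for y
      proof (cases "y \<in> range g")
        case True
        then obtain a where "y = g a" by auto
        then have "\<phi> g (a, True) = y" by (simp add: \<phi>_def)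
        then show ?thesis by (metis rangeI)
      next
        case y: False
        then have "\<phi> g (y, False) = y" using False by (simp add: \<phi>_def)
        then show ?thesis by (metis rangeI)
      qed
      then show ?thesis by auto
    qed
    then have "range (\<phi> g \<circ> w0) = UNIV" using w0(1) by (metis image_comp)
    then show ?thesis using surj_full_in_M[OF N full_comp[OF w0(2)]] by blast
  qed
  define \<psi> where "\<psi> p = f (map (\<lambda>g. \<phi> g p) gs)" for p
  define u where "u = \<psi> \<circ> w0"
  have u_apply: "u = apply_unary f (map (\<lambda>g. \<phi> g \<circ> w0) gs)" unfolding u_def \<psi>_def apply_unary_def by (auto simp: comp_def)
  have "u \<in> M" unfolding u_apply using f M by (intro M_app) auto
  moreover have "full u" unfolding u_def using w0(2) by (rule full_comp)
  moreover have "\<not> small (- range u)"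
  proof -
    define E where "E = (\<Union>g\<in>set gs - Q. - range g)"
    have "small E" unfolding E_def
      by (rule small_UN) (use f(3) in \<open>auto simp: small_finite nearly_onto_or_def\<close>)
    then have "small (\<psi> ` (E \<times> {False}))"
    proof -
      have "\<psi> ` (E \<times> {False}) = (\<lambda>a. \<psi> (a, False)) ` E" by auto
      then show ?thesis using \<open>small E\<close> small_image by metis
    qed
    then have "\<not> small (- range (apply_unary f gs) - \<psi> ` (E \<times> {False}))"
      using f(4) by (intro not_small_Diff) (auto simp: nearly_onto_or_def)
    moreover have "range u \<subseteq> range (apply_unary f gs) \<union> \<psi> ` (E \<times> {False})"
    proof
      fix y assume "y \<in> range u"
      then obtain a b where ab: "y = \<psi> (a, b)" unfolding u_def by (metis comp_apply imageE surj_pair)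
      show "y \<in> range (apply_unary f gs) \<union> \<psi> ` (E \<times> {False})"
      proof (cases "\<not> b \<and> a \<in> E")
        case True
        then show ?thesis using ab by auto
      next
        case False
        then have "\<phi> g (a, b) = g a" if "g \<in> set gs" for g
          using that unfolding \<phi>_def E_def by auto
        then have "y = apply_unary f gs a" using ab unfolding \<psi>_def apply_unary_def by (simp cong: map_cong)
        then show ?thesis by auto
      qed
    qed
    ultimately show ?thesis using small_mono[of "- range (apply_unary f gs) - \<psi> ` (E \<times> {False})" "- range u"] by blast
  qed
  moreover have "apply_unary f gs \<notin> Q" using f(4) by (simp add: nearly_onto_or_def)
  moreover have "range (apply_unary f gs) \<subseteq> range u"
  proof
    fix y assume "y \<in> range (apply_unary f gs)"
    then obtain a where a: "y = apply_unary f gs a" by auto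
    obtain x where "w0 x = (a, True)" using w0(1) by (metis UNIV_I imageE)
    then have "u x = y" unfolding a u_def \<psi>_def apply_unary_def \<phi>_def by simp
    then show "y \<in> range u" by auto
  qed
  ultimately show ?thesis by blast
qed

text \<open>With \<open>Q\<close> empty, a function of colarge range followed by constants puts all
  constants into \<open>M\<close>. With \<open>Q = constants\<close>, a full function of colarge
  range has two different values; one of its fibres is matched with \<open>P\<close> by a
  permutation and its values are collapsed to two.\<close>

lemma two_valued_in_M:
  assumes N: "\<exists>w\<in>M. full w \<and> range w = UNIV"
    and K: "\<not> C \<subseteq> Pol (nearly_onto_or {})" "\<not> C \<subseteq> Pol (nearly_onto_or constants)"
    and P: "\<not> small P" "\<not> small (- P)"
  shows "(\<lambda>x. if x \<in> P then c else c') \<in> M"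
proof -
  obtain u where "u \<in> M" "\<not> small (- range u)"
    using ex_colarge_range[OF N _ _ K(1)] by blast
  from comp_in_M[OF N this] have "(\<lambda>_. c) \<circ> u \<in> M" for c .
  then have "constants \<subseteq> M" unfolding constants_def by (auto simp: comp_def)
  moreover have "g \<circ> k \<in> constants" if "g \<in> constants" for g k
    using that by (auto simp: constants_def comp_def)
  ultimately obtain u h where u: "u \<in> M" "full u" "\<not> small (- range u)" "h \<notin> constants" "range h \<subseteq> range u"
    using ex_colarge_range[OF N _ _ K(2)] by metis
  obtain a where "h a \<noteq> h undefined"
  proof (rule ccontr)
    assume "\<not> thesis"
    then have "h = (\<lambda>_. h undefined)" using that by blast
    then show False using u(4) unfolding constants_def by blast
  qed
  moreover have "h a \<in> range u" "h undefined \<in> range u" using u(5) by auto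
  ultimately obtain y z where yz: "y \<noteq> z" "y \<in> range u" "z \<in> range u" by metis
  define P' where "P' = u -` {y}"
  have P': "\<not> small P'" using u(2) yz(2) unfolding full_def P'_def by blast
  have "u -` {z} \<subseteq> - P'" using yz(1) unfolding P'_def by auto
  moreover have "\<not> small (u -` {z})" using u(2) yz(3) unfolding full_def by blast
  ultimately have P'c: "\<not> small (- P')" using small_mono by blast
  obtain q1 q2 where q12: "bij_betw q1 P P'" "bij_betw q2 (- P) (- P')"
    using ex_bij_large[OF P(1) card_of_le_U P' card_of_le_U] ex_bij_large[OF P(2) card_of_le_U P'c card_of_le_U]
    by blast
  define q where "q x = (if x \<in> P then q1 x else q2 x)" for x
  have "bij q" unfolding q_def using q12 by (rule bij_if_combine)
  moreover have "q x \<in> P' \<longleftrightarrow> x \<in> P" for x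
    using q12 unfolding q_def bij_betw_def by auto
  then have "(\<lambda>x. if x \<in> P then c else c') = ((\<lambda>v. if v = y then c else c') \<circ> u) \<circ> q"
    unfolding P'_def by (auto simp: fun_eq_iff)
  ultimately show ?thesis using M_comp[OF comp_in_M[OF N u(1,3)] M_perm] by metis
qed

text \<open>Tuples with pairwise different values of \<open>f\<close> are spread over the base set
  as values of the functions \<open>v i\<close>, so the composite is injective; the tuples at
  \<open>False\<close> are kept back to make its range colarge. Component \<open>i\<close> is
  controlled only at indices with \<open>k j = i\<close>, and \<open>good\<close> asks for no
  more.\<close>

lemma tuples_give_M_UNIV:
  assumes N: "\<exists>w\<in>M. full w \<and> range w = UNIV" and f: "(n, f) \<in> C"
    and J: "|J| \<le>o |U|" "\<not> small J" "\<forall>j\<in>J. k j < n \<and> \<not> small (slice_image n f (k j) (c j))"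
    and good: "\<And>i w b. i < n \<Longrightarrow> bij_betw b UNIV J \<Longrightarrow> (\<And>j. j \<in> J \<Longrightarrow> k j = i \<Longrightarrow> w j = c j) \<Longrightarrow> w \<circ> b \<in> M"
  shows "M = UNIV"
proof -
  have "|J \<times> (UNIV :: bool set)| \<le>o |U|" by (rule card_of_Times_le_U[OF J(1) finite_le_U]) simp
  then obtain t where t: "\<forall>i\<in>J \<times> (UNIV :: bool set). length (t i) = n \<and> t i ! k (fst i) = c (fst i) \<and> f (t i) \<notin> {}"
    "inj_on (f \<circ> t) (J \<times> UNIV)"
    using tuple_choice[of "J \<times> (UNIV :: bool set)" "{}" n f "\<lambda>i. k (fst i)" "\<lambda>i. c (fst i)"] J(3) by auto
  obtain b where b: "bij_betw b (UNIV :: 'a set) J"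
    using ex_bij_large[OF not_small_U(2) card_of_le_U J(2,1)] by blast
  have bJ: "b x \<in> J" for x using b by (auto simp: bij_betw_def)
  define v where "v i = (\<lambda>j. t (j, True) ! i) \<circ> b" for i
  define u where "u = apply_unary f (map v [0..<n])"
  have "v i \<in> M" if "i < n" for i
    unfolding v_def by (rule good[OF that b]) (use t in auto)
  then have "u \<in> M" unfolding u_def using f by (intro M_app) auto
  moreover have u: "u x = (f \<circ> t) (b x, True)" for x
  proof -
    have "map (\<lambda>i. v i x) [0..<n] = t (b x, True)"
      using t(1) bJ[of x] by (intro nth_equalityI) (auto simp: v_def)
    then show ?thesis unfolding u_def apply_unary_def by (simp add: comp_def)
  qed
  moreover have "inj u"
  proof (rule injI)
    fix x y assume "u x = u y"
    then have "(b x, True) = (b y, True)"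
      unfolding u using bJ by (intro inj_onD[OF t(2)]) auto
    then show "x = y" using b by (auto simp: bij_betw_def inj_on_def)
  qed
  moreover have "\<not> small (- range u)"
  proof -
    have "inj_on (f \<circ> t) (J \<times> {False})" by (rule inj_on_subset[OF t(2)]) auto
    then have "\<not> small ((f \<circ> t) ` (J \<times> {False}))"
      using not_small_Times(1)[OF J(2), of "{False}"] by (simp only: small_image_iff) auto
    moreover have "(f \<circ> t) ` (J \<times> {False}) \<subseteq> - range u"
    proof -
      have "(f \<circ> t) (j, False) \<noteq> u x" if "j \<in> J" for j x
      proof
        assume "(f \<circ> t) (j, False) = u x"
        then have "(j, False) = (b x, True)" unfolding u using bJ that by (intro inj_onD[OF t(2)]) auto
        then show False by simp
      qed
      then show ?thesis by auto
    qed
    ultimately show ?thesis using small_mono by blast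
  qed
  ultimately show ?thesis using inj_imp_M_UNIV[OF N] by blast
qed

end

section \<open>Almost unary operations\<close>

context regular_universe begin

text \<open>
  This clone contains all unary functions, so it cannot contain a maximal clone that does not.
\<close>

definition almost_unary :: "'a operation set" where
  "almost_unary = {(n, f) \<in> operations. \<exists>k<n. \<forall>c. small (slice_image n f k c)}"

lemma not_small_vimage:
  assumes "bij_betw b UNIV J" "A \<subseteq> J" "\<not> small A"
  shows "\<not> small (b -` A)"
proof -
  have "b ` (b -` A) = A" using assms(1,2) by (auto simp: bij_betw_def)
  then show ?thesis using assms(3) small_image by metis
qed

text \<open>If argument \<open>k\<close> controls \<open>f\<close> and argument \<open>j\<close>
  controls the \<open>k\<close>-th inner operation, then \<open>j\<close> controls the composite:
  its slice images are covered by small unions of small sets.\<close>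

lemma clone_almost_unary: "clone almost_unary"
  unfolding clone_def
proof (intro conjI allI impI)
  show "almost_unary \<subseteq> operations" by (auto simp: almost_unary_def)
next
  fix n i :: nat assume "i < n"
  moreover have "small (slice_image n (\<lambda>xs\<in>tuples n. xs ! i) i c)" for c :: 'a
    by (rule small_mono[of _ "{c}"]) (auto simp: slice_image_def tuples_def small_finite)
  ultimately show "projection n i \<in> almost_unary"
    using projection_in_operations[of i n] by (auto simp: almost_unary_def projection_def)
next
  fix n m and f :: "'a list \<Rightarrow> 'a" and gs
  assume *: "(n, f) \<in> almost_unary \<and> length gs = n \<and> (\<forall>g\<in>set gs. (m, g) \<in> almost_unary)"
  then obtain k where k: "k < n" "\<And>c. small (slice_image n f k c)" by (auto simp: almost_unary_def)
  with * obtain j where j: "j < m" "\<And>c. small (slice_image m (gs ! k) j c)"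
    by (auto simp: almost_unary_def dest!: nth_mem)
  have "small (slice_image m (\<lambda>xs\<in>tuples m. f (map (\<lambda>g. g xs) gs)) j c)" for c
  proof (rule small_mono)
    show "slice_image m (\<lambda>xs\<in>tuples m. f (map (\<lambda>g. g xs) gs)) j c
      \<subseteq> (\<Union>d\<in>slice_image m (gs ! k) j c. slice_image n f k d)"
      using * k(1) by (auto simp: slice_image_def tuples_def intro!: imageI bexI)
    show "small (\<Union>d\<in>slice_image m (gs ! k) j c. slice_image n f k d)"
      using j k by (intro small_UN) auto
  qed
  moreover have "compose_ops m f gs \<in> operations"
    by (rule compose_ops_in_operations) (use * in \<open>auto simp: almost_unary_def\<close>)
  ultimately show "compose_ops m f gs \<in> almost_unary"
    using j(1) by (auto simp: almost_unary_def compose_ops_def)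
qed

lemma unary_almost_unary: "unary h \<in> almost_unary"
proof -
  have "small (slice_image 1 (\<lambda>xs\<in>tuples 1. h (xs ! 0)) 0 c)" for c
    by (rule small_mono[of _ "{h c}"]) (auto simp: slice_image_def tuples_def small_finite)
  then show ?thesis using unary_in_operations[of h] by (auto simp: almost_unary_def unary_def)
qed

lemma almost_unary_neq_operations: "almost_unary \<noteq> operations"
proof
  assume eq: "almost_unary = operations"
  obtain e :: "'a \<times> 'a \<Rightarrow> 'a" where e: "bij_betw e (UNIV \<times> UNIV) UNIV"
    using ex_bij_Times[OF not_small_U(2) card_of_le_U UNIV_not_empty card_of_le_U] by blast
  let ?f = "\<lambda>xs\<in>tuples 2. e (xs ! 0, xs ! 1)"
  have "(2, ?f) \<in> almost_unary" unfolding eq by (simp add: operations_iff)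
  then obtain k where k: "k < 2" "\<And>c. small (slice_image 2 ?f k c)" by (auto simp: almost_unary_def)
  have e_inj: "inj e" using e by (simp add: bij_betw_def)
  fix c :: 'a
  have "\<not> small (slice_image 2 ?f k c)"
  proof (cases "k = 0")
    case True
    have "(\<lambda>y. e (c, y)) ` UNIV \<subseteq> slice_image 2 ?f k c"
    proof safe
      fix y
      have m: "[c, y] \<in> {xs. length xs = 2 \<and> xs ! k = c}" and v: "?f [c, y] = e (c, y)"
        using True by (auto simp: tuples_def)
      show "e (c, y) \<in> slice_image 2 ?f k c" unfolding slice_image_def by (rule image_eqI[where f = ?f, OF v[symmetric] m])
    qed
    moreover have inj: "inj (\<lambda>y. e (c, y))" by (rule injI) (use e_inj in \<open>auto dest: injD\<close>)
    have "\<not> small ((\<lambda>y. e (c, y)) ` UNIV)" unfolding small_image_iff[OF inj] by (rule not_small_U)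
    ultimately show ?thesis using small_mono by blast
  next
    case False
    have "(\<lambda>y. e (y, c)) ` UNIV \<subseteq> slice_image 2 ?f k c"
    proof safe
      fix y
      have m: "[y, c] \<in> {xs. length xs = 2 \<and> xs ! k = c}" and v: "?f [y, c] = e (y, c)"
        using False k(1) by (auto simp: tuples_def less_2_cases_iff)
      show "e (y, c) \<in> slice_image 2 ?f k c" unfolding slice_image_def by (rule image_eqI[where f = ?f, OF v[symmetric] m])
    qed
    moreover have inj: "inj (\<lambda>y. e (y, c))" by (rule injI) (use e_inj in \<open>auto dest: injD\<close>)
    have "\<not> small ((\<lambda>y. e (y, c)) ` UNIV)" unfolding small_image_iff[OF inj] by (rule not_small_U)
    ultimately show ?thesis using small_mono by blast
  qed
  then show False using k(2) by blast
qed

end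

section \<open>All unary functions from an operation that is not almost unary\<close>

context perm_clone begin

text \<open>
  On a large set the \<open>k\<close>-th argument is \<open>c\<close>, which confines the values to a small set and leaves room
  to make the other arguments onto; on the complement it is \<open>c'\<close> and the values are distinct.
\<close>

lemma large_fibre_in_M:
  assumes N: "\<exists>w\<in>M. full w \<and> range w = UNIV"
    and K: "\<not> C \<subseteq> Pol (nearly_onto_or {})" "\<not> C \<subseteq> Pol (nearly_onto_or constants)"
    and f: "(n, f) \<in> C" and k: "k < n" "small (slice_image n f k c)" "\<not> small (slice_image n f k c')"
    and g: "\<not> small (g -` {y})"
  shows "g \<in> M"
proof -
  define F where "F = slice_image n f k c"
  define I where "I = (UNIV :: 'a set) \<times> (UNIV :: bool set)"
  have I: "|I| \<le>o |U|" unfolding I_def by (intro card_of_Times_le_U card_of_le_U finite_le_U) simp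
  \<comment> \<open>Only tuples at \<open>True\<close> are fed to \<open>f\<close>; the values at
    \<open>False\<close> stay outside the range of \<open>u\<close> and make it colarge.\<close>
  obtain t where t: "\<forall>i\<in>I. length (t i) = n \<and> t i ! k = c' \<and> f (t i) \<notin> F" "inj_on (f \<circ> t) I"
    using tuple_choice[OF I, of F n f "\<lambda>_. k" "\<lambda>_. c'"] k by (auto simp: F_def)
  have t1: "length (t i) = n" "t i ! k = c'" "f (t i) \<notin> F" for i
    using bspec[OF t(1), of i] by (simp_all add: I_def)
  have t_inj: "f (t i) = f (t i') \<longleftrightarrow> i = i'" for i i'
    using inj_on_eq_iff[OF t(2), of i i'] by (simp add: I_def)
  obtain w where w: "w \<in> M" "full w" "range w = UNIV" using N by blast
  have "\<not> small I" unfolding I_def by (intro not_small_Times not_small_U) simp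
  then obtain b where b: "bij_betw b (UNIV :: 'a set) I"
    using ex_bij_large[OF not_small_U(2) card_of_le_U _ I] by blast
  have b_vimage: "\<not> small (b -` (A \<times> {z}))" if "\<not> small A" for A :: "'a set" and z
  proof -
    have "b ` (b -` (A \<times> {z})) = A \<times> {z}"
      using b by (auto simp: bij_betw_def I_def image_iff)
    moreover have "\<not> small (A \<times> {z})" using that by (intro not_small_Times) simp_all
    ultimately show ?thesis using small_image by metis
  qed
  define P where "P = {x. snd (b x)}"
  have P_eq: "P = b -` (UNIV \<times> {True})" "- P = b -` (UNIV \<times> {False})"
    unfolding P_def by (auto simp: mem_Times_iff)
  then have P: "\<not> small P" "\<not> small (- P)" using b_vimage not_small_U by auto
  define v where "v i x = (if x \<in> P then t (b x) ! i else if i = k then c else w (fst (b x)))" for i x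
  have "v i \<in> M" if "i < n" for i
  proof (cases "i = k")
    case True
    then have "v i = (\<lambda>x. if x \<in> P then c' else c)"
      using t1 unfolding v_def by (auto simp: fun_eq_iff)
    then show ?thesis using two_valued_in_M[OF N K P] by simp
  next
    case False
    have fib: "\<not> small (v i -` {z})" for z
    proof -
      have "b -` ((w -` {z}) \<times> {False}) \<subseteq> v i -` {z}"
        using False by (auto simp: v_def P_def)
      moreover have "\<not> small (w -` {z})" using w unfolding full_def by auto
      ultimately show ?thesis using b_vimage small_mono by blast
    qed
    have "z \<in> range (v i)" for z
    proof -
      have "v i -` {z} \<noteq> {}" using fib by (metis small_empty)
      then show ?thesis by auto
    qed
    then show ?thesis using surj_full_in_M[OF N] fib unfolding full_def by blast
  qed
  define u where "u = apply_unary f (map v [0..<n])"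
  have u_M: "u \<in> M" unfolding u_def using f \<open>\<And>i. i < n \<Longrightarrow> v i \<in> M\<close> by (intro M_app) auto
  have u_P: "u x = f (t (b x))" if "x \<in> P" for x
  proof -
    have "map (\<lambda>i. v i x) [0..<n] = t (b x)"
      using t1 that by (intro nth_equalityI) (auto simp: v_def)
    then show ?thesis unfolding u_def apply_unary_def by (simp add: comp_def)
  qed
  have u_nP: "u x \<in> F" if "x \<notin> P" for x
  proof -
    have "map (\<lambda>i. v i x) [0..<n] ! k = c" using that k(1) by (simp add: v_def)
    then show ?thesis unfolding u_def apply_unary_def F_def slice_image_def by (auto simp: comp_def intro!: imageI)
  qed
  have "\<not> small (- range u)"
  proof -
    have "(f \<circ> t) ` (UNIV \<times> {False}) \<subseteq> - range u"
    proof safe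
      fix a x assume eq: "(f \<circ> t) (a, False) = u x"
      then have "x \<in> P" using u_nP[of x] t1(3)[of "(a, False)"] by auto
      with eq have "(a, False) = b x" using u_P t_inj by auto
      then show False using \<open>x \<in> P\<close> unfolding P_def by (metis mem_Collect_eq snd_conv)
    qed
    moreover have "inj_on (f \<circ> t) (UNIV \<times> {False})"
      using t_inj by (auto simp: inj_on_def)
    then have "\<not> small ((f \<circ> t) ` (UNIV \<times> {False}))"
      using not_small_Times(1)[OF not_small_U(2), of "{False}"] by (simp only: small_image_iff) auto
    ultimately show ?thesis using small_mono by blast
  qed
  note post = comp_in_M[OF N u_M this]
  \<comment> \<open>All points that \<open>g\<close> does not send to \<open>y\<close> are moved
    into \<open>P\<close>, where \<open>u\<close> is injective and can be decoded; the values of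
    \<open>u\<close> off \<open>P\<close> lie in \<open>F\<close> and decode to
    \<open>y\<close>.\<close>
  obtain q where q: "bij q" "q ` (- (g -` {y})) \<subseteq> P"
    using ex_perm_into[of "- (g -` {y})" P] g P(1) by auto
  have u_inj: "inj_on u P"
    using u_P t_inj b by (auto simp: inj_on_def bij_betw_def)
  define \<phi> where "\<phi> z = (if z \<in> u ` P then g (inv q (inv_into P u z)) else y)" for z
  have "g x = (\<phi> \<circ> u \<circ> q) x" for x
  proof (cases "q x \<in> P")
    case True
    then show ?thesis using u_inj q(1) by (simp add: \<phi>_def bij_is_inj)
  next
    case False
    then have "u (q x) \<notin> u ` P" using u_nP[OF False] u_P t1(3) by (metis imageE)
    moreover have "g x = y" using False q(2) by auto
    ultimately show ?thesis by (simp add: \<phi>_def)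
  qed
  then have "g = \<phi> \<circ> u \<circ> q" by auto
  then show ?thesis using M_comp[OF post M_perm[OF q(1)]] by simp
qed

text \<open>If some slice has a small image, functions with a large fibre are in \<open>M\<close>,
  so it suffices that component \<open>i\<close> is constant on block \<open>i\<close> of
  \<open>J\<close>. If none has, the constants on the slices are free, and block \<open>i\<close>
  makes component \<open>i\<close> take every value on a large set, hence a full surjection.\<close>

lemma M_UNIV:
  assumes N: "\<exists>w\<in>M. full w \<and> range w = UNIV"
    and K: "\<not> C \<subseteq> Pol (nearly_onto_or {})" "\<not> C \<subseteq> Pol (nearly_onto_or constants)"
    and T: "\<not> C \<subseteq> almost_unary"
  shows "M = UNIV"
proof -
  obtain n f where f: "(n, f) \<in> C" "(n, f) \<notin> almost_unary" using T by (metis subsetI surj_pair)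
  have "(n, f) \<in> operations" using f(1) clone by (auto simp: clone_def)
  with f(2) have n: "n \<ge> 1" and ex: "\<And>k. k < n \<Longrightarrow> \<exists>c. \<not> small (slice_image n f k c)"
    by (auto simp: almost_unary_def operations_iff)
  show ?thesis
  proof (cases "\<exists>k<n. \<exists>c. small (slice_image n f k c)")
    case True
    then obtain k c where k: "k < n" "small (slice_image n f k c)" by blast
    obtain c' where c': "\<not> small (slice_image n f k c')" using ex k(1) by blast
    obtain ck where ck: "\<And>k. k < n \<Longrightarrow> \<not> small (slice_image n f k (ck k))" using ex by metis
    define J where "J = {..<n} \<times> (UNIV :: 'a set)"
    show ?thesis
    proof (rule tuples_give_M_UNIV[OF N f(1), of J fst "\<lambda>j. ck (fst j)"])
      show "|J| \<le>o |U|" unfolding J_def by (intro card_of_Times_le_U card_of_le_U finite_le_U) simp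
      show "\<not> small J" unfolding J_def
        by (rule not_small_Times(2)[OF not_small_U(2)]) (use n in \<open>auto simp: lessThan_empty_iff\<close>)
      show "\<forall>j\<in>J. fst j < n \<and> \<not> small (slice_image n f (fst j) (ck (fst j)))" using ck by (auto simp: J_def)
      fix i w and b :: "'a \<Rightarrow> nat \<times> 'a" assume i: "i < n" and b: "bij_betw b UNIV J"
        and w: "\<And>j. j \<in> J \<Longrightarrow> fst j = i \<Longrightarrow> w j = ck (fst j)"
      have "b -` ({i} \<times> UNIV) \<subseteq> (w \<circ> b) -` {ck i}" using w i by (auto simp: J_def)
      moreover have "\<not> small (b -` ({i} \<times> UNIV))"
        by (rule not_small_vimage[OF b _ not_small_Times(2)[OF not_small_U(2)]]) (use i in \<open>auto simp: J_def\<close>)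
      ultimately have "\<not> small ((w \<circ> b) -` {ck i})" using small_mono by blast
      then show "w \<circ> b \<in> M" by (rule large_fibre_in_M[OF N K f(1) k c'])
    qed
  next
    case False
    define J where "J = {..<n} \<times> (UNIV :: 'a set) \<times> (UNIV :: 'a set)"
    show ?thesis
    proof (rule tuples_give_M_UNIV[OF N f(1), of J fst "\<lambda>j. fst (snd j)"])
      show "|J| \<le>o |U|" unfolding J_def by (intro card_of_Times_le_U card_of_le_U finite_le_U) simp
      show "\<not> small J" unfolding J_def
        by (rule not_small_Times(2)[OF not_small_Times(1)[OF not_small_U(2) UNIV_not_empty]]) (use n in \<open>auto simp: lessThan_empty_iff\<close>)
      show "\<forall>j\<in>J. fst j < n \<and> \<not> small (slice_image n f (fst j) (fst (snd j)))" using False by (auto simp: J_def)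
      fix i w and b :: "'a \<Rightarrow> nat \<times> 'a \<times> 'a" assume i: "i < n" and b: "bij_betw b UNIV J"
        and w: "\<And>j. j \<in> J \<Longrightarrow> fst j = i \<Longrightarrow> w j = fst (snd j)"
      have fib: "\<not> small ((w \<circ> b) -` {y})" for y
      proof -
        have "b -` ({i} \<times> {y} \<times> UNIV) \<subseteq> (w \<circ> b) -` {y}" using w i by (auto simp: J_def)
        moreover have "\<not> small (b -` ({i} \<times> {y} \<times> UNIV))"
          by (rule not_small_vimage[OF b _ not_small_Times(2)[OF not_small_Times(2)[OF not_small_U(2)]]])
            (use i in \<open>auto simp: J_def\<close>)
        ultimately show ?thesis using small_mono by blast
      qed
      have "y \<in> range (w \<circ> b)" for y
      proof -
        have "(w \<circ> b) -` {y} \<noteq> {}" using fib by (metis small_empty)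
        then show ?thesis by auto
      qed
      then show "w \<circ> b \<in> M" using surj_full_in_M[OF N] fib unfolding full_def by blast
    qed
  qed
qed

end

context regular_universe begin

section \<open>Maximality of the polymorphism clones of the sets G\<close>

lemma id_in_G_set: "id \<in> G_set D"
  by (auto simp: G_set_def dest: ordIso_symmetric ordIso_imp_ordLeq)

text \<open>Every value outside \<open>V\<close> is taken on both halves of a doubled base set.
  Removing \<open>B\<close> from one half loses no value, so the missed points are still only those
  of \<open>V\<close>.\<close>

lemma ex_not_in_G_set:
  fixes V D :: "'a set"
  assumes "|V| <o |D|"
  shows "\<exists>u. u \<notin> G_set D \<and> - range u = V"
proof -
  have V: "small V" unfolding small_def using assms card_of_le_U ordLess_ordLeq_trans by blast
  then obtain d where d: "d \<notin> V" using not_small_U small_mono by (metis UNIV_I subsetI)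
  obtain j where j: "bij_betw j ((UNIV :: 'a set) \<times> (UNIV :: bool set)) (UNIV :: 'a set)"
    using ex_bij_Times[OF not_small_U(2) card_of_le_U UNIV_not_empty finite_le_U[OF finite]] by blast
  define r where "r a = (if a \<in> V then d else a)" for a
  have r: "range r = - V" unfolding r_def using d by auto
  define u where "u = r \<circ> fst \<circ> inv j"
  have ju: "u (j p) = r (fst p)" for p using j by (simp add: u_def bij_betw_def)
  have "|D| \<le>o |j ` (UNIV \<times> {True})|"
  proof -
    have "inj_on j (UNIV \<times> {True})" using j by (auto simp: bij_betw_def elim: inj_on_subset)
    then have "\<not> small (j ` (UNIV \<times> {True}))"
      using not_small_Times(1)[OF not_small_U(2), of "{True}"] by (simp only: small_image_iff) auto
    then show ?thesis unfolding not_small using card_of_le_U ordLeq_transitive by blast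
  qed
  then obtain B where B: "B \<subseteq> j ` (UNIV \<times> {True})" "|D| =o |B|"
    using internalize_card_of_ordLeq2[THEN iffD1] by blast
  have "j (a, False) \<notin> B" for a
  proof
    assume "j (a, False) \<in> B"
    then obtain a' where "j (a, False) = j (a', True)" using B(1) by auto
    then show False using j by (simp add: bij_betw_def inj_eq)
  qed
  then have "range r \<subseteq> u ` (- B)" using ju[of "(_, False)"]
    by (metis (no_types, lifting) ComplI fst_conv image_eqI image_subsetI)
  moreover have ru: "range u \<subseteq> range r" unfolding u_def by auto
  moreover have "u ` (- B) \<subseteq> range u" by auto
  ultimately have "u ` (- B) = range r" "range u = range r" by blast+
  then have "- u ` (- B) = V" "- range u = V" using r by auto
  moreover have "\<not> |D| \<le>o |V|" using assms not_ordLess_ordLeq by blast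
  ultimately show ?thesis using B(2) ordIso_symmetric unfolding G_set_def
    by (intro exI[of _ u]) auto
qed

lemma in_G_setI:
  assumes "|D| \<le>o |- range u|"
  shows "u \<in> G_set D"
proof -
  have "|D| \<le>o |- u ` (- B)|" for B
    by (rule ordLeq_transitive[OF assms card_of_mono1]) auto
  then show ?thesis by (simp add: G_set_def)
qed

lemma G_set_cong: "|D| =o |D'| \<Longrightarrow> G_set D = G_set D'"
proof -
  have "G_set D \<subseteq> G_set D'" if "|D| =o |D'|" for D D' :: "'b set"
    using that unfolding G_set_def
    by (auto dest: ordIso_transitive ordIso_symmetric intro: ordIso_ordLeq_trans)
  then show "|D| =o |D'| \<Longrightarrow> G_set D = G_set D'" using ordIso_symmetric by blast
qed

text \<open>The points that \<open>v\<close> misses after the removal of \<open>B\<close> contain a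
  set of size \<open>|D|\<close> whose removal can be applied to \<open>u\<close>.\<close>

lemma comp_in_G_set:
  fixes D :: "'a set"
  assumes "u \<in> G_set D" "v \<in> G_set D"
  shows "u \<circ> v \<in> G_set D"
  unfolding G_set_def
proof safe
  fix B :: "'a set" assume "|B| =o |D|"
  then have "|D| \<le>o |- v ` (- B)|" using assms(2) unfolding G_set_def by blast
  then obtain B' where B': "B' \<subseteq> - v ` (- B)" "|D| =o |B'|"
    using internalize_card_of_ordLeq2[THEN iffD1] by blast
  then have "|D| \<le>o |- u ` (- B')|" using assms(1) ordIso_symmetric unfolding G_set_def by blast
  moreover have "- u ` (- B') \<subseteq> - (u \<circ> v) ` (- B)" using B'(1) by auto
  ultimately show "|D| \<le>o |- (u \<circ> v) ` (- B)|" using card_of_mono1 ordLeq_transitive by blast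
qed

lemma bij_in_G_set:
  fixes D :: "'a set"
  shows "bij p \<Longrightarrow> p \<in> G_set D"
  unfolding G_set_def
proof safe
  fix B :: "'a set" assume "bij p" "|B| =o |D|"
  then have "- p ` (- B) = p ` B" by (metis bij_image_Compl_eq double_complement)
  moreover have "|p ` B| =o |B|"
    using \<open>bij p\<close> by (metis bij_betw_def card_of_ordIsoI inj_on_subset ordIso_symmetric subset_UNIV)
  ultimately show "|D| \<le>o |- p ` (- B)|"
    using \<open>|B| =o |D|\<close> by (metis ordIso_iff_ordLeq ordLeq_transitive)
qed

lemma unary_in_Pol_G_set:
  fixes D :: "'a set"
  shows "unary u \<in> Pol (G_set D) \<longleftrightarrow> u \<in> G_set D"
  unfolding unary_in_Pol using comp_in_G_set[of u D] bspec[of "G_set D" "\<lambda>v. u \<circ> v \<in> G_set D" id] id_in_G_set[of D]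
  by auto

text \<open>
  A function \<open>u\<close> in a larger clone \<open>E\<close> but outside \<open>G_set D\<close> maps \<open>- B\<close> onto \<open>- V\<close> with \<open>|V| < |D|\<close>; lifting along
  \<open>u\<close> shows that \<open>E\<close> contains every operation avoiding \<open>V\<close>. The binary \<open>f0\<close> below is onto even on
  \<open>- V\<close>, but omits \<open>|D|\<close> values as soon as its first argument omits a point outside \<open>V\<close>, which every
  function omitting \<open>|D|\<close> points does.
\<close>

lemma maximal_clone_Pol_G_set:
  fixes D :: "'a set"
  assumes "D \<noteq> {}"
  shows "maximal_clone (Pol (G_set D))"
  unfolding maximal_clone_def
proof (intro conjI notI)
  show "clone (Pol (G_set D))" by (rule clone_Pol)
  have "|{} :: 'a set| <o |D|" using card_of_ordLess2[OF assms, of "{} :: 'a set"] assms by simp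
  then obtain u where "u \<notin> G_set D" using ex_not_in_G_set by blast
  then show "Pol (G_set D) = operations \<Longrightarrow> False"
    using unary_in_Pol_G_set unary_in_operations by metis
  assume "\<exists>E. clone E \<and> Pol (G_set D) \<subset> E \<and> E \<subset> operations"
  then obtain E where E: "clone E" "Pol (G_set D) \<subset> E" "E \<subset> operations" by blast
  then obtain n f gs where f: "(n, f) \<in> E" "length gs = n" "set gs \<subseteq> G_set D" "apply_unary f gs \<notin> G_set D"
    using not_in_PolE[OF E(1)] by (metis less_le_not_le)
  have "set gs \<subseteq> unary_part E" using f(3) unary_in_Pol_G_set E(2) by (auto simp: unary_part_def)
  then have u: "unary (apply_unary f gs) \<in> E" using apply_in_unary_part[OF E(1) f(1,2)] by (simp add: unary_part_def)
  define u where "u = apply_unary f gs"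
  obtain B where B: "|B| =o |D|" "\<not> |D| \<le>o |- u ` (- B)|" using f(4) unfolding G_set_def u_def by blast
  define V where "V = - u ` (- B)"
  have V: "|V| <o |D|" using B(2) by (simp add: V_def not_ordLeq_iff_ordLess card_of_Well_order)
  then have small_V: "small V" unfolding small_def using card_of_le_U ordLess_ordLeq_trans by blast
  have avoid: "(m, F) \<in> E" if F: "(m, F) \<in> operations" "\<And>xs. length xs = m \<Longrightarrow> F xs \<notin> V" for m F
  proof -
    have "\<exists>a. a \<notin> B \<and> u a = F xs" if "length xs = m" for xs
      using F(2)[OF that] unfolding V_def by auto
    then obtain s where s: "\<And>xs. length xs = m \<Longrightarrow> s xs \<notin> B \<and> u (s xs) = F xs" by metis
    \<comment> \<open>The lift takes no value in \<open>B\<close>, so every composite with it misses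
      at least \<open>|D|\<close> points.\<close>
    let ?s = "\<lambda>xs\<in>tuples m. s xs"
    have "(m, ?s) \<in> Pol (G_set D)"
    proof -
      have "apply_unary ?s vs \<in> G_set D" if "length vs = m" for vs
      proof (rule in_G_setI)
        have "B \<subseteq> - range (apply_unary ?s vs)" using s that by (auto simp: apply_unary_def tuples_def)
        then show "|D| \<le>o |- range (apply_unary ?s vs)|"
          using B(1) card_of_mono1 ordIso_ordLeq_trans ordIso_symmetric by blast
      qed
      then show ?thesis using F(1) by (auto simp: Pol_def operations_iff)
    qed
    then have "compose_ops m (\<lambda>xs\<in>tuples 1. u (xs ! 0)) [?s] \<in> E"
      using E u unfolding clone_def unary_def u_def by auto
    moreover have "compose_ops m (\<lambda>xs\<in>tuples 1. u (xs ! 0)) [?s] = (m, F)"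
      using s F(1) by (auto simp: compose_ops_def tuples_def operations_iff fun_eq_iff extensional_def)
    ultimately show ?thesis by simp
  qed
  obtain x0 where x0: "x0 \<notin> V" using not_small_U small_V small_mono by (metis UNIV_I subsetI)
  \<comment> \<open>The first factor registers an omitted argument, the second turns it into
    \<open>|D|\<close> omitted values.\<close>
  obtain e where e: "bij_betw e ((- V) \<times> D) (UNIV :: 'a set)"
  proof -
    have "\<not> small ((- V) \<times> D)" using not_small_Compl[OF small_V] assms by (intro not_small_Times)
    then show ?thesis
      using that ex_bij_large[OF _ card_of_Times_le_U[OF card_of_le_U card_of_le_U] not_small_U(2) card_of_le_U]
      by blast
  qed
  have "|D| \<le>o |- V|"
    using not_small_Compl[OF small_V] card_of_le_U[of D] ordLeq_transitive unfolding not_small by blast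
  then obtain \<rho> where \<rho>: "\<rho> ` (- V) = D"
    unfolding card_of_ordLeq2[OF assms, symmetric] by blast
  have \<rho>D: "\<rho>' y \<in> D" if "\<rho>' = (\<lambda>y. if y \<in> V then \<rho> x0 else \<rho> y)" for \<rho>' y
    using \<rho> x0 that by auto
  define \<rho>' where "\<rho>' = (\<lambda>y. if y \<in> V then \<rho> x0 else \<rho> y)"
  define b where "b x = (if x \<in> V then x0 else x)" for x
  define f0 where "f0 = (\<lambda>xs\<in>tuples 2. e (b (xs ! 0), \<rho>' (xs ! 1)))"
  have f0: "(2, f0) \<in> Pol (G_set D)"
  proof -
    have "apply_unary f0 [g1, g2] \<in> G_set D" if g: "g1 \<in> G_set D" "g2 \<in> G_set D" for g1 g2
      unfolding G_set_def
    proof safe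
      fix B :: "'a set" assume "|B| =o |D|"
      then have *: "|D| \<le>o |- g1 ` (- B)|" using g(1) unfolding G_set_def by blast
      obtain z where z: "z \<notin> V" "z \<notin> b ` g1 ` (- B)"
      proof (cases "\<exists>v\<in>V. v \<in> g1 ` (- B)")
        case True
        then obtain v where v: "v \<in> V" "v \<in> g1 ` (- B)" by blast
        \<comment> \<open>\<open>b\<close> sends \<open>V\<close> to \<open>x0\<close>, so the
          missed point sought must also differ from \<open>x0\<close>. Since \<open>v\<close> is
          hit, it can be traded for \<open>x0\<close> and the excluded points remain fewer than
          \<open>|D|\<close>.\<close>
        have "|insert x0 (V - {v})| \<le>o |V|"
          by (rule card_of_ordLeqI[of "\<lambda>z. if z = x0 then v else z"]) (use v x0 in \<open>auto simp: inj_on_def split: if_splits\<close>)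
        then have "|insert x0 (V - {v})| <o |- g1 ` (- B)|"
          using V * ordLeq_ordLess_trans ordLess_ordLeq_trans by blast
        then have "\<not> - g1 ` (- B) \<subseteq> insert x0 (V - {v})"
          using card_of_mono1 not_ordLess_ordLeq by blast
        then obtain z where "z \<notin> g1 ` (- B)" "z \<noteq> x0" "z \<notin> V" using v by blast
        then show ?thesis using that[of z] unfolding b_def by auto
      next
        case False
        have "|V| <o |- g1 ` (- B)|" using V * ordLess_ordLeq_trans by blast
        then have "\<not> - g1 ` (- B) \<subseteq> V" using card_of_mono1 not_ordLess_ordLeq by blast
        then obtain z where "z \<notin> g1 ` (- B)" "z \<notin> V" by blast
        then show ?thesis using that[of z] False unfolding b_def by auto
      qed
      have "e ` ({z} \<times> D) \<subseteq> - apply_unary f0 [g1, g2] ` (- B)"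
      proof safe
        fix d x assume d: "d \<in> D" and x: "x \<notin> B" and eq: "e (z, d) = apply_unary f0 [g1, g2] x"
        have "apply_unary f0 [g1, g2] x = e (b (g1 x), \<rho>' (g2 x))" by (simp add: apply_unary_def f0_def tuples_def)
        with eq have "(z, d) = (b (g1 x), \<rho>' (g2 x))"
          using d z(1) x0 \<rho>D[OF \<rho>'_def] e unfolding b_def by (intro inj_onD[of e "(- V) \<times> D"]) (auto simp: bij_betw_def)
        then show False using z(2) x by auto
      qed
      moreover have "|D| \<le>o |e ` ({z} \<times> D)|"
      proof (rule card_of_ordLeqI[of "\<lambda>d. e (z, d)"])
        show "inj_on (\<lambda>d. e (z, d)) D"
          using e z(1) by (auto simp: bij_betw_def inj_on_def)
      qed auto
      ultimately show "|D| \<le>o |- apply_unary f0 [g1, g2] ` (- B)|"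
        using card_of_mono1 ordLeq_transitive by blast
    qed
    then have "apply_unary f0 vs \<in> G_set D" if "length vs = 2" "set vs \<subseteq> G_set D" for vs
      using that by (auto simp: numeral_2_eq_2 length_Suc_conv)
    moreover have "(2, f0) \<in> operations" by (simp add: f0_def operations_iff)
    ultimately show ?thesis by (auto simp: Pol_def)
  qed
  have f0E: "(2, f0) \<in> E" using E(2) f0 by blast
  have "(m, F) \<in> E" if F: "(m, F) \<in> operations" for m F
  proof -
    \<comment> \<open>Decoding along \<open>e\<close> writes \<open>F\<close> as \<open>f0\<close>
      of two operations that avoid \<open>V\<close>.\<close>
    define i where "i y = inv_into ((- V) \<times> D) e y" for y
    have i: "i y \<in> (- V) \<times> D" "e (i y) = y" for y
      unfolding i_def using e by (auto simp: bij_betw_def f_inv_into_f intro: inv_into_into)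
    define s where "s d = (SOME y. y \<in> - V \<and> \<rho> y = d)" for d
    have s: "s d \<in> - V \<and> \<rho> (s d) = d" if "d \<in> D" for d
      unfolding s_def by (rule someI_ex) (use \<rho> that in auto)
    let ?F1 = "\<lambda>xs\<in>tuples m. fst (i (F xs))" and ?F2 = "\<lambda>xs\<in>tuples m. s (snd (i (F xs)))"
    have "(m, ?F1) \<in> E" "(m, ?F2) \<in> E"
      using i s F by (intro avoid; force simp: operations_iff tuples_def mem_Times_iff)+
    then have "compose_ops m f0 [?F1, ?F2] \<in> E"
      by (intro clone_compose_ops[OF E(1) f0E]) auto
    moreover have "compose_ops m f0 [?F1, ?F2] = (m, F)"
    proof -
      have "f0 [fst (i (F xs)), s (snd (i (F xs)))] = F xs" for xs
      proof -
        have "fst (i (F xs)) \<notin> V" "snd (i (F xs)) \<in> D" using i(1)[of "F xs"] by (auto simp: mem_Times_iff)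
        then show ?thesis using s[of "snd (i (F xs))"] i(2)[of "F xs"]
          by (simp add: f0_def tuples_def b_def \<rho>'_def)
      qed
      then show ?thesis using F
        by (auto simp: compose_ops_def operations_iff fun_eq_iff extensional_def tuples_def)
    qed
    ultimately show ?thesis by simp
  qed
  then show False using E(3) by auto
qed

end

section \<open>Counting\<close>

definition permutation_clones :: "'a operation set set" where
  "permutation_clones = {C. maximal_clone C \<and> unary ` {p. bij p} \<subseteq> C \<and> \<not> range unary \<subseteq> C}"

context regular_universe begin

lemma proper_family:
  assumes "K \<in> {few_large_fibres, no_large_fibre, nearly_onto_or {}, nearly_onto_or constants} \<union> G_set ` (- {{}})"
  shows "id \<in> K" "K \<noteq> (UNIV :: ('a \<Rightarrow> 'a) set)"
proof -
  have vimage_id: "id -` {y} = {y}" for y :: 'a by auto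
  have "id \<in> few_large_fibres" "id \<in> no_large_fibre" unfolding few_large_fibres_def no_large_fibre_def
    by (auto simp only: vimage_id mem_Collect_eq small_finite finite.intros simp_thms) (simp add: small_finite)
  moreover have "id \<in> nearly_onto_or Q" for Q by (simp add: nearly_onto_or_def)
  ultimately show "id \<in> K" using assms id_in_G_set by auto
  obtain w :: "'a \<Rightarrow> 'a" where w: "range w = UNIV" "full w"
    using ex_full_surj_UNIV[OF UNIV_not_empty card_of_le_U] by blast
  then have "{y. \<not> small (w -` {y})} = UNIV" unfolding full_def by auto
  then have "w \<notin> few_large_fibres" "w \<notin> no_large_fibre" using not_small_U unfolding few_large_fibres_def no_large_fibre_def by auto
  obtain a b :: 'a where ab: "a \<noteq> b"
    by (metis U_UNIV infinite_U finite.simps UNIV_eq_I singletonI small_finite ex_new_if_finite insert_iff)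
  define t where "t x = (if x = a then a else b)" for x
  have "range t \<subseteq> {a, b}" unfolding t_def by auto
  then have "small (range t)" using small_mono small_finite by (metis finite.emptyI finite.insertI)
  then have "\<not> small (- range t)" by (rule not_small_Compl)
  moreover have "t \<notin> constants" using ab unfolding constants_def t_def by (auto simp: fun_eq_iff) metis
  ultimately have "t \<notin> nearly_onto_or constants" "t \<notin> nearly_onto_or {}" by (auto simp: nearly_onto_or_def)
  moreover have "\<exists>u. u \<notin> G_set D" if "D \<noteq> {}" for D :: "'a set"
    using ex_not_in_G_set[of "{}" D] card_of_ordLess2[OF that, of "{} :: 'a set"] that by auto
  ultimately show "K \<noteq> UNIV" using assms \<open>w \<notin> few_large_fibres\<close> \<open>w \<notin> no_large_fibre\<close> by auto
qed

lemma permutation_clones_cases: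
  assumes "(C :: 'a operation set) \<in> permutation_clones"
  shows "C \<in> Pol ` ({few_large_fibres, no_large_fibre, nearly_onto_or {}, nearly_onto_or constants} \<union> G_set ` (- {{}}))"
proof (rule ccontr)
  assume not: "C \<notin> Pol ` ({few_large_fibres, no_large_fibre, nearly_onto_or {}, nearly_onto_or constants} \<union> G_set ` (- {{}}))"
  have C: "maximal_clone C" "unary ` {p. bij p} \<subseteq> C" "\<not> range unary \<subseteq> C"
    using assms by (auto simp: permutation_clones_def)
  have cl: "clone C" using C(1) by (simp add: maximal_clone_def)
  interpret perm_clone U C
    by unfold_locales (use cl C(2) in auto)
  have nsub: "\<not> C \<subseteq> Pol K" if "K \<in> {few_large_fibres, no_large_fibre, nearly_onto_or {}, nearly_onto_or constants} \<union> G_set ` (- {{}})" for K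
    using maximal_clone_eq[OF C(1) clone_Pol Pol_neq_operations[OF proper_family[OF that]]] not that by blast
  have "\<not> C \<subseteq> almost_unary"
    using maximal_clone_eq[OF C(1) clone_almost_unary almost_unary_neq_operations] C(3) unary_almost_unary by auto
  moreover have "\<exists>w\<in>M. full w \<and> range w = UNIV"
    by (rule ex_full_surj_in_M; rule nsub; simp)
  moreover have "\<not> C \<subseteq> Pol (nearly_onto_or {})" "\<not> C \<subseteq> Pol (nearly_onto_or constants)" by (rule nsub; simp)+
  ultimately have "M = UNIV" by (intro M_UNIV)
  then show False using C(3) by (auto simp: unary_part_def)
qed

lemma Pol_G_set_in_permutation_clones:
  fixes D :: "'a set"
  assumes "D \<noteq> {}"
  shows "Pol (G_set D) \<in> permutation_clones"
proof -
  have "G_set D \<noteq> UNIV" using proper_family(2)[of "G_set D"] assms by auto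
  then show ?thesis
    using maximal_clone_Pol_G_set[OF assms] bij_in_G_set unary_in_Pol_G_set by (auto simp: permutation_clones_def)
qed

lemma Pol_G_set_neq:
  fixes D D' :: "'a set"
  assumes "|D| <o |D'|"
  shows "Pol (G_set D) \<noteq> Pol (G_set D')"
proof -
  obtain u where u: "u \<notin> G_set D'" "- range u = D" using ex_not_in_G_set[OF assms] by blast
  then have "u \<in> G_set D" by (intro in_G_setI) (simp add: ordIso_imp_ordLeq card_of_refl)
  with u(1) show ?thesis using unary_in_Pol_G_set by metis
qed

end

section \<open>Cardinals up to that of the base set\<close>

lemma card_of_less_finite:
  assumes "finite A" "card A < card B"
  shows "|A| <o |B|"
proof -
  have "\<not> |B| \<le>o |A|"
    unfolding card_of_ordLeq[symmetric] using assms card_inj_on_le[of _ B A] by (auto simp: not_le)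
  then show ?thesis by (simp add: not_ordLeq_iff_ordLess card_of_Well_order)
qed

text \<open>Take the first index \<open>b\<close> with \<open>A b\<close> not below
  \<open>|D|\<close>; it exists because \<kappa> is least above all the \<open>A b\<close>.
  Minimality of \<open>A b\<close> above the earlier alephs gives the other inequality.\<close>

lemma infinite_cardinal_is_aleph:
  fixes D :: "'a set" and \<alpha> :: "'b rel" and A :: "'b \<Rightarrow> 'a rel"
  assumes \<alpha>: "Well_order \<alpha>"
    and A: "\<And>b. b \<in> Field \<alpha> \<Longrightarrow> least_infinite_above (A ` underS \<alpha> b) (A b)"
    and \<kappa>: "least_infinite_above (A ` Field \<alpha>) \<kappa>"
    and D: "infinite D" "|D| <o \<kappa>"
  shows "\<exists>b\<in>Field \<alpha>. |D| =o A b"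
proof -
  have Dinf: "Cinfinite |D|" using D(1) by (simp add: cinfinite_def Field_card_of card_of_card_order_on)
  define Q where "Q = {b \<in> Field \<alpha>. \<not> A b <o |D|}"
  have "Q \<noteq> {}"
  proof
    assume "Q = {}"
    then have "\<kappa> \<le>o |D|" using \<kappa> Dinf unfolding least_infinite_above_def Q_def by blast
    then show False using D(2) not_ordLess_ordLeq by blast
  qed
  moreover have "wf (\<alpha> - Id)" using \<alpha> by (simp add: well_order_on_def)
  ultimately obtain b where b: "b \<in> Q" "\<And>b'. (b', b) \<in> \<alpha> - Id \<Longrightarrow> b' \<notin> Q"
    by (metis ex_in_conv wfE_min)
  have bF: "b \<in> Field \<alpha>" and not: "\<not> A b <o |D|" using b(1) by (auto simp: Q_def)
  have "A b' <o |D|" if "b' \<in> underS \<alpha> b" for b'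
    using b(2)[of b'] that unfolding Q_def underS_def by (auto simp: Field_def)
  then have "A b \<le>o |D|" using A[OF bF] Dinf unfolding least_infinite_above_def by blast
  moreover from this have "|D| \<le>o A b"
    using not by (metis ordLeq_iff_ordLess_or_ordIso ordIso_iff_ordLeq)
  ultimately show ?thesis using bF ordIso_iff_ordLeq by blast
qed

theorem corollary2:
  fixes \<alpha> :: "'b rel"
  assumes aleph: "is_aleph \<alpha> |UNIV :: 'a set|"
    and regular: "regularCard |UNIV :: 'a set|"
  shows "|{C :: 'a operation set. maximal_clone C \<and>
             unary ` {p. bij p} \<subseteq> C \<and> \<not> range unary \<subseteq> C}|
         =o card_max |Field \<alpha>| natLeq"
proof -
  obtain A :: "'b \<Rightarrow> 'a rel" where \<alpha>: "Well_order \<alpha>"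
    and A: "\<And>b. b \<in> Field \<alpha> \<Longrightarrow> least_infinite_above (A ` underS \<alpha> b) (A b)"
    and \<kappa>: "least_infinite_above (A ` Field \<alpha>) |UNIV :: 'a set|"
    using aleph unfolding is_aleph_def by blast
  have inf: "infinite (UNIV :: 'a set)"
    using \<kappa> unfolding least_infinite_above_def cinfinite_def by (simp add: Field_card_of)
  interpret regular_universe "UNIV :: 'a set"
    by unfold_locales (use inf regular in auto)
  define g where "g D = Pol (G_set D)" for D :: "'a set"
  have g_cong: "g D = g D'" if "|D| =o |D'|" for D D' using G_set_cong[OF that] by (simp add: g_def)
  have FA: "|Field (A b)| =o A b" "infinite (Field (A b))" if "b \<in> Field \<alpha>" for b
    using A[OF that] card_of_Field_ordIso unfolding least_infinite_above_def cinfinite_def by auto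
  have "\<exists>D :: 'a set. finite D \<and> card D = n" for n
    using infinite_arbitrarily_large[OF inf] by metis
  then obtain F :: "nat \<Rightarrow> 'a set" where F: "\<And>n. finite (F n)" "\<And>n. card (F n) = n" by metis
  \<comment> \<open>\<open>T1\<close> is the countable part: the special sets, the full cardinality
    and the finite ones. The infinite cardinals strictly between belong to
    \<open>T2\<close>.\<close>
  define T1 where "T1 = Pol ` {few_large_fibres, no_large_fibre, nearly_onto_or {}, nearly_onto_or constants} \<union> {g UNIV} \<union> range (g \<circ> F)"
  define T2 where "T2 = (\<lambda>b. g (Field (A b))) ` Field \<alpha>"
  have upper: "permutation_clones \<subseteq> T1 \<union> T2"
  proof
    fix C :: "'a operation set" assume "C \<in> permutation_clones"
    from permutation_clones_cases[OF this] consider "C \<in> Pol ` {few_large_fibres, no_large_fibre, nearly_onto_or {}, nearly_onto_or constants}" | D where "C = g D"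
      unfolding g_def by auto
    then show "C \<in> T1 \<union> T2"
    proof cases
      case 1
      then show ?thesis unfolding T1_def by blast
    next
      case (2 D)
      show ?thesis
      proof (cases "finite D")
        case True
        then have "|D| =o |F (card D)|"
          using F finite_same_card_bij card_of_ordIso by metis
        then have "C = (g \<circ> F) (card D)" using g_cong 2 by auto
        then show ?thesis unfolding T1_def by blast
      next
        case False
        consider "|D| =o |UNIV :: 'a set|" | "|D| <o |UNIV :: 'a set|"
          using card_of_le_U ordLeq_iff_ordLess_or_ordIso by blast
        then show ?thesis
        proof cases
          case 1
          then show ?thesis using g_cong 2 by (auto simp: T1_def)
        next
          case less: 2
          obtain b where b: "b \<in> Field \<alpha>" "|D| =o A b"
            using infinite_cardinal_is_aleph[OF \<alpha> A \<kappa> False less] by blast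
          then have "|D| =o |Field (A b)|" using FA(1) ordIso_symmetric ordIso_transitive by blast
          then have "C = g (Field (A b))" using g_cong 2 by auto
          then show ?thesis using b(1) unfolding T2_def by blast
        qed
      qed
    qed
  qed
  have T1: "|T1| \<le>o |UNIV :: nat set|"
  proof -
    have "countable T1" unfolding T1_def by auto
    then show ?thesis unfolding countable_def card_of_ordLeq[symmetric] by blast
  qed
  have T2: "|T2| \<le>o |Field \<alpha>|" unfolding T2_def by (rule card_of_image)
  have nat_le: "|UNIV :: nat set| \<le>o |permutation_clones :: 'a operation set set|"
  proof (rule card_of_ordLeqI)
    \<comment> \<open>\<open>Suc\<close> excludes the empty set, whose \<open>G_set\<close> contains
      all functions.\<close>
    show "g (F (Suc n)) \<in> permutation_clones" for n
      unfolding g_def using F[of "Suc n"] by (intro Pol_G_set_in_permutation_clones) auto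
    show "inj (\<lambda>n. g (F (Suc n)))"
    proof (rule linorder_injI)
      fix m n :: nat assume "m < n"
      then have "|F (Suc m)| <o |F (Suc n)|" using F by (intro card_of_less_finite) auto
      then show "g (F (Suc m)) \<noteq> g (F (Suc n))" unfolding g_def by (rule Pol_G_set_neq)
    qed
  qed
  have field_le: "|Field \<alpha>| \<le>o |permutation_clones :: 'a operation set set|"
  proof (rule card_of_ordLeqI)
    show "g (Field (A b)) \<in> permutation_clones" if "b \<in> Field \<alpha>" for b
      unfolding g_def using FA(2)[OF that] by (intro Pol_G_set_in_permutation_clones) auto
    have less: "g (Field (A b)) \<noteq> g (Field (A b'))" if "b \<in> Field \<alpha>" "b' \<in> Field \<alpha>" "b \<in> underS \<alpha> b'" for b b'
    proof -
      have "A b <o A b'" using A[OF that(2)] that(3) unfolding least_infinite_above_def by blast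
      then have "|Field (A b)| <o |Field (A b')|"
        by (rule ordIso_ordLess_trans[OF FA(1)[OF that(1)]
              ordLess_ordIso_trans[OF _ ordIso_symmetric[OF FA(1)[OF that(2)]]]])
      then show ?thesis unfolding g_def by (rule Pol_G_set_neq)
    qed
    show "inj_on (\<lambda>b. g (Field (A b))) (Field \<alpha>)"
    proof (rule inj_onI, rule ccontr)
      fix b b' assume b: "b \<in> Field \<alpha>" "b' \<in> Field \<alpha>" "g (Field (A b)) = g (Field (A b'))" "b \<noteq> b'"
      have "total_on (Field \<alpha>) \<alpha>" using \<alpha> by (simp add: well_order_on_def linear_order_on_def)
      then have "b \<in> underS \<alpha> b' \<or> b' \<in> underS \<alpha> b" using b by (auto simp: total_on_def underS_def)
      then show False using less b by metis
    qed
  qed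
  \<comment> \<open>Both values of the maximum are treated at once, with \<open>K\<close> the set of
    naturals or the field of \<alpha>.\<close>
  have main: "|permutation_clones :: 'a operation set set| =o |K|"
    if "infinite K" "|UNIV :: nat set| \<le>o |K|" "|Field \<alpha>| \<le>o |K|" "|K| \<le>o |permutation_clones :: 'a operation set set|" for K :: "'k set"
  proof -
    have "|T1 \<union> T2| \<le>o |K|"
      by (rule card_of_Un_ordLeq_infinite_Field)
        (use that T1 T2 in \<open>auto simp: Field_card_of card_of_card_order_on elim: ordLeq_transitive\<close>)
    then have "|permutation_clones :: 'a operation set set| \<le>o |K|" using upper card_of_mono1 ordLeq_transitive by blast
    with that(4) show ?thesis by (simp add: ordIso_iff_ordLeq)
  qed
  have "|permutation_clones :: 'a operation set set| =o card_max |Field \<alpha>| natLeq"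
  proof (cases "|Field \<alpha>| \<le>o natLeq")
    case True
    have "|UNIV :: nat set| =o |Inr ` (UNIV :: nat set) :: ('b + nat) set|"
      by (rule card_of_ordIsoI[of Inr]) (auto simp: bij_betw_def)
    moreover have "|permutation_clones :: 'a operation set set| =o |UNIV :: nat set|"
      using ordLeq_ordIso_trans[OF True ordIso_symmetric[OF card_of_nat]] nat_le
      by (intro main) (auto intro: card_of_mono1)
    ultimately show ?thesis
      using True by (simp add: card_max_def Field_natLeq) (metis ordIso_transitive)
  next
    case False
    then have "natLeq \<le>o |Field \<alpha>|"
      by (simp add: not_ordLeq_iff_ordLess card_of_Well_order natLeq_Well_order ordLess_imp_ordLeq)
    then have le: "|UNIV :: nat set| \<le>o |Field \<alpha>|" using card_of_nat ordIso_ordLeq_trans by blast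
    then have "infinite (Field \<alpha>)" by (simp add: infinite_iff_card_of_nat)
    then have "|permutation_clones :: 'a operation set set| =o |Field \<alpha>|"
      using le field_le by (intro main) (auto intro: card_of_mono1)
    moreover have "|Field \<alpha>| =o |Inl ` Field \<alpha> :: ('b + nat) set|"
      by (rule card_of_ordIsoI[of Inl]) (auto simp: bij_betw_def)
    ultimately show ?thesis
      using False by (simp add: card_max_def Field_card_of) (metis ordIso_transitive)
  qed
  then show ?thesis by (simp add: permutation_clones_def)
qed

end
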